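(* Let $k$ be a Bergman-type kernel on the unit disc $\mathbb D$, of the form $$k(z,w)=\frac{1}{1-\varphi(z)\overline{\varphi(w)}\,(1-u(z)u(w)^* )},\qquad z,w\in\mathbb D .$$ Let $\mathcal H$ be a Hilbert space of analytic functions on $\mathbb D$ whose reproducing kernel is normalized at $0$, and assume that $\varphi\in\mathrm{Mult}(\mathcal H)$, that the range of $M_\varphi$ is closed of co-dimension $1$ in $\mathcal H$, and that $u\in\mathrm{Mult}(\mathcal H\otimes\ell^2,\mathcal H)$. Then $\mathcal H=\mathcal H_k(b)$ for some analytic row-contraction $b$ in $\mathbb D$ with $b(0)=0$ if and only if $$\Big\|f_0+\sum_{n\ge1}u_nf_n\Big\|^2\le\|\varphi f_0\|^2+\sum_{n\ge1}\|f_n\|^2$$ whenever $f_0,f_1,\dots,f_n,\dots\in\mathcal H$ (all norms being those of $\mathcal H$; the inequality is understood for sequences with $\sum_n\|f_n\|^2<\infty$).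
   Context: A Bergman-type kernel is a reproducing kernel (positive semi-definite function) on $\mathbb D$ of the displayed form, where $\varphi$ is a scalar analytic function on $\mathbb D$ with $\varphi(0)=0$, $u=(u_1,u_2,\dots)$ is an analytic $\ell^2$-row-vector valued function on $\mathbb D$, $u(z)u(w)^*=\sum_n u_n(z)\overline{u_n(w)}$, and $k(z,z)\to\infty$ as $|z|\to1^-$; the function $\varphi(z)/z$ can be (and is) chosen outer and bounded from above and below. A kernel $h$ on $\mathbb D$ is normalized at $0$ if $h(z,0)=1$ for all $z\in\mathbb D$. $\mathrm{Mult}(\mathcal H)$ is the set of functions $\phi$ with $\phi f\in\mathcal H$ for all $f\in\mathcal H$, and $M_\phi f=\phi f$. $\mathcal H\otimes\ell^2$ is the space of $\ell^2$-valued functions $(f_1,f_2,\dots)$ with $f_n\in\mathcal H$ and $\sum\|f_n\|^2<\infty$; $u\in\mathrm{Mult}(\mathcal H\otimes\ell^2,\mathcal H)$ means $\sum_n u_nf_n\in\mathcal H$ for all such $(f_n)$. An analytic row-contraction $b$ in $\mathbb D$ is an analytic row-vector valued function $b:\mathbb D\to\ell^2$ with $\|b(z)\|_{\ell^2}\le1$ for all $z$. $\mathcal H_k(b)$ is the Hilbert function space with reproducing kernel $k(z,w)(1-b(z)b(w)^* )$, $b(z)b(w)^*=\langle b(z),b(w)\rangle_{\ell^2}$; so $\mathcal H=\mathcal H_k(b)$ means that the reproducing kernel of $\mathcal H$ is $k(z,w)(1-b(z)b(w)^* )$. *)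

theory Defs
  imports "HOL-Analysis.Analysis"
begin

abbreviation disc :: "complex set" where
  "disc \<equiv> ball 0 1"

subsection \<open>Square-summable sequences\<close>

definition l2 :: "(nat \<Rightarrow> complex) set" where
  "l2 = {a. summable (\<lambda>n. (cmod (a n))\<^sup>2)}"

definition l2_norm :: "(nat \<Rightarrow> complex) \<Rightarrow> real" where
  "l2_norm a = sqrt (\<Sum>n. (cmod (a n))\<^sup>2)"

definition l2_inner :: "(nat \<Rightarrow> complex) \<Rightarrow> (nat \<Rightarrow> complex) \<Rightarrow> complex" where
  "l2_inner a b = (\<Sum>n. a n * cnj (b n))"

text \<open>
  An \<open>l2\<close>-valued function is analytic on the disc if it is complex differentiable there in the
  norm of \<open>l2\<close>. Entry \<open>u z n\<close> is the component with index \<open>n + 1\<close> of a row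
  \<open>(u\<^sub>1, u\<^sub>2, \<dots>)\<close>.
\<close>

definition l2_analytic :: "(complex \<Rightarrow> nat \<Rightarrow> complex) \<Rightarrow> bool" where
  "l2_analytic u \<longleftrightarrow>
     (\<forall>z\<in>disc. u z \<in> l2) \<and>
     (\<forall>z\<in>disc. \<exists>d\<in>l2.
        ((\<lambda>w. l2_norm (\<lambda>n. (u w n - u z n) / (w - z) - d n)) \<longlongrightarrow> 0) (at z))"

definition analytic_row_contraction :: "(complex \<Rightarrow> nat \<Rightarrow> complex) \<Rightarrow> bool" where
  "analytic_row_contraction b \<longleftrightarrow> l2_analytic b \<and> (\<forall>z\<in>disc. l2_norm (b z) \<le> 1)"

subsection \<open>Bergman-type kernels\<close>

definition psd_kernel :: "(complex \<Rightarrow> complex \<Rightarrow> complex) \<Rightarrow> bool" where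
  "psd_kernel k \<longleftrightarrow>
     (\<forall>X c. finite X \<and> X \<subseteq> disc \<longrightarrow>
        (\<Sum>z\<in>X. \<Sum>w\<in>X. c z * cnj (c w) * k z w) \<in> \<real> \<and>
        0 \<le> Re (\<Sum>z\<in>X. \<Sum>w\<in>X. c z * cnj (c w) * k z w))"

text \<open>
  Outer functions are the functions given by the usual integral formula; \<open>h\<close> is the logarithm
  of the modulus of the boundary function.
\<close>

definition outer_function :: "(complex \<Rightarrow> complex) \<Rightarrow> bool" where
  "outer_function g \<longleftrightarrow>
     (\<exists>c h. cmod c = 1 \<and> set_integrable lborel {0..2*pi} (h :: real \<Rightarrow> real) \<and>
        (\<forall>z\<in>disc. g z =
           c * exp (1 / (2 * of_real pi) *
             (LBINT t:{0..2*pi}. (cis t + z) / (cis t - z) * of_real (h t)))))"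

text \<open>
  The function \<open>g\<close> below is \<open>\<phi>(z)/z\<close> with its singularity at \<open>0\<close> removed.
  The denominator is required not to vanish, since division by zero is total.
\<close>

definition bergman_type_kernel ::
  "(complex \<Rightarrow> complex) \<Rightarrow> (complex \<Rightarrow> nat \<Rightarrow> complex) \<Rightarrow> (complex \<Rightarrow> complex \<Rightarrow> complex) \<Rightarrow> bool"
where
  "bergman_type_kernel \<phi> u k \<longleftrightarrow>
     \<phi> holomorphic_on disc \<and> \<phi> 0 = 0 \<and>
     (\<exists>g. g holomorphic_on disc \<and> (\<forall>z\<in>disc. \<phi> z = z * g z) \<and> outer_function g \<and>
        (\<exists>m M. 0 < m \<and> (\<forall>z\<in>disc. m \<le> cmod (g z) \<and> cmod (g z) \<le> M))) \<and>
     l2_analytic u \<and>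
     (\<forall>z\<in>disc. \<forall>w\<in>disc.
        1 - \<phi> z * cnj (\<phi> w) * (1 - l2_inner (u z) (u w)) \<noteq> 0 \<and>
        k z w = 1 / (1 - \<phi> z * cnj (\<phi> w) * (1 - l2_inner (u z) (u w)))) \<and>
     psd_kernel k \<and>
     filterlim (\<lambda>z. Re (k z z)) at_top (filtercomap cmod (at_left 1))"

subsection \<open>Hilbert spaces of analytic functions on the disc\<close>

text \<open>
  A function on the disc is represented by its extension by \<open>0\<close>, so that equality of members of
  the space is equality on the disc. A space is given by its set \<open>H\<close> of members and its inner
  product \<open>ip\<close>, which is linear in the first argument and only relevant on \<open>H\<close>.
\<close>

type_synonym cfun = "complex \<Rightarrow> complex"

definition hnorm :: "(cfun \<Rightarrow> cfun \<Rightarrow> complex) \<Rightarrow> cfun \<Rightarrow> real" where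
  "hnorm ip f = sqrt (Re (ip f f))"

definition inner_product_function_space :: "cfun set \<Rightarrow> (cfun \<Rightarrow> cfun \<Rightarrow> complex) \<Rightarrow> bool" where
  "inner_product_function_space H ip \<longleftrightarrow>
     (\<forall>f\<in>H. \<forall>z. z \<notin> disc \<longrightarrow> f z = 0) \<and>
     (\<lambda>z. 0) \<in> H \<and>
     (\<forall>f\<in>H. \<forall>g\<in>H. (\<lambda>z. f z + g z) \<in> H) \<and>
     (\<forall>c. \<forall>f\<in>H. (\<lambda>z. c * f z) \<in> H) \<and>
     (\<forall>f\<in>H. \<forall>g\<in>H. \<forall>h\<in>H. ip (\<lambda>z. f z + g z) h = ip f h + ip g h) \<and>
     (\<forall>c. \<forall>f\<in>H. \<forall>g\<in>H. ip (\<lambda>z. c * f z) g = c * ip f g) \<and>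
     (\<forall>f\<in>H. \<forall>g\<in>H. ip g f = cnj (ip f g)) \<and>
     (\<forall>f\<in>H. 0 \<le> Re (ip f f) \<and> (ip f f = 0 \<longrightarrow> f = (\<lambda>z. 0)))"

definition hilbert_analytic_space :: "cfun set \<Rightarrow> (cfun \<Rightarrow> cfun \<Rightarrow> complex) \<Rightarrow> bool" where
  "hilbert_analytic_space H ip \<longleftrightarrow>
     inner_product_function_space H ip \<and>
     (\<forall>f\<in>H. f holomorphic_on disc) \<and>
     (\<forall>F :: nat \<Rightarrow> cfun. (\<forall>n. F n \<in> H) \<and>
        (\<forall>e>0. \<exists>N. \<forall>m\<ge>N. \<forall>n\<ge>N. hnorm ip (\<lambda>z. F m z - F n z) < e) \<longrightarrow>
        (\<exists>f\<in>H. (\<lambda>n. hnorm ip (\<lambda>z. F n z - f z)) \<longlonglongrightarrow> 0))"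

definition kernel_section :: "(complex \<Rightarrow> complex \<Rightarrow> complex) \<Rightarrow> complex \<Rightarrow> cfun" where
  "kernel_section K w = (\<lambda>z. if z \<in> disc then K z w else 0)"

definition has_reproducing_kernel ::
  "cfun set \<Rightarrow> (cfun \<Rightarrow> cfun \<Rightarrow> complex) \<Rightarrow> (complex \<Rightarrow> complex \<Rightarrow> complex) \<Rightarrow> bool"
where
  "has_reproducing_kernel H ip K \<longleftrightarrow>
     (\<forall>w\<in>disc. kernel_section K w \<in> H \<and> (\<forall>f\<in>H. ip f (kernel_section K w) = f w))"

definition normalized_at_0 :: "(complex \<Rightarrow> complex \<Rightarrow> complex) \<Rightarrow> bool" where
  "normalized_at_0 K \<longleftrightarrow> (\<forall>z\<in>disc. K z 0 = 1)"

text \<open>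
  A Hilbert function space is determined by its reproducing kernel, so
  \<open>H = H\<^sub>k(b)\<close>, as Hilbert spaces, says that \<open>H\<close> has the kernel defining \<open>H\<^sub>k(b)\<close>.
\<close>

definition is_H_kb ::
  "cfun set \<Rightarrow> (cfun \<Rightarrow> cfun \<Rightarrow> complex) \<Rightarrow> (complex \<Rightarrow> complex \<Rightarrow> complex) \<Rightarrow>
     (complex \<Rightarrow> nat \<Rightarrow> complex) \<Rightarrow> bool"
where
  "is_H_kb H ip k b \<longleftrightarrow>
     has_reproducing_kernel H ip (\<lambda>z w. k z w * (1 - l2_inner (b z) (b w)))"

subsection \<open>Multipliers\<close>

definition Mult :: "cfun set \<Rightarrow> cfun set" where
  "Mult H = {\<phi>. \<forall>f\<in>H. (\<lambda>z. \<phi> z * f z) \<in> H}"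

text \<open>The elements of \<open>H \<otimes> l2\<close>, as sequences in \<open>H\<close>.\<close>

definition H_l2 :: "cfun set \<Rightarrow> (cfun \<Rightarrow> cfun \<Rightarrow> complex) \<Rightarrow> (nat \<Rightarrow> cfun) set" where
  "H_l2 H ip = {F. (\<forall>n. F n \<in> H) \<and> summable (\<lambda>n. (hnorm ip (F n))\<^sup>2)}"

definition row_mult :: "(complex \<Rightarrow> nat \<Rightarrow> complex) \<Rightarrow> (nat \<Rightarrow> cfun) \<Rightarrow> cfun" where
  "row_mult u F = (\<lambda>z. \<Sum>n. u z n * F n z)"

definition Mult_row ::
  "cfun set \<Rightarrow> (cfun \<Rightarrow> cfun \<Rightarrow> complex) \<Rightarrow> (complex \<Rightarrow> nat \<Rightarrow> complex) set"
where
  "Mult_row H ip = {u. \<forall>F\<in>H_l2 H ip. row_mult u F \<in> H}"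

definition mult_range :: "cfun set \<Rightarrow> cfun \<Rightarrow> cfun set" where
  "mult_range H \<phi> = (\<lambda>f z. \<phi> z * f z) ` H"

definition closed_in_H :: "cfun set \<Rightarrow> (cfun \<Rightarrow> cfun \<Rightarrow> complex) \<Rightarrow> cfun set \<Rightarrow> bool" where
  "closed_in_H H ip R \<longleftrightarrow>
     (\<forall>F f. (\<forall>n::nat. F n \<in> R) \<and> f \<in> H \<and> (\<lambda>n. hnorm ip (\<lambda>z. F n z - f z)) \<longlonglongrightarrow> 0
        \<longrightarrow> f \<in> R)"

text \<open>For a linear subspace \<open>R\<close> of \<open>H\<close>: the quotient \<open>H/R\<close> is spanned by one nonzero class.\<close>

definition codim_1_in_H :: "cfun set \<Rightarrow> cfun set \<Rightarrow> bool" where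
  "codim_1_in_H H R \<longleftrightarrow>
     (\<exists>e\<in>H. e \<notin> R \<and> (\<forall>f\<in>H. \<exists>c. (\<lambda>z. f z - c * e z) \<in> R))"

end

theory Submission
  imports Defs "HOL-Complex_Analysis.Cauchy_Integral_Formula"
begin

text \<open>
  Put \<open>E = 1 - K / k\<close>. Since \<open>K\<close> is normalized, the range of multiplication by \<open>\<phi>\<close> is the subspace of
  functions vanishing at \<open>0\<close>, whose kernel is \<open>K - 1\<close>. Computing the adjoint of \<open>(f0, F) \<mapsto> f0 + \<Sum> u F\<close>
  on kernel combinations therefore shows that this map is a contraction exactly when
  \<open>K - u u\<^sup>* K - (K - 1) / (\<phi> \<phi>\<^sup>*) = E / (\<phi> \<phi>\<^sup>*)\<close> is positive semi-definite off \<open>0\<close>, that is, when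
  \<open>E\<close> is positive semi-definite. A factorization \<open>E = b b\<^sup>*\<close> is equivalent to \<open>K = k (1 - b b\<^sup>*)\<close>, and it is
  obtained by taking successive Schur complements of \<open>E\<close> along a dense sequence of points; \<open>E \<le> 1\<close> on the
  diagonal makes \<open>b\<close> a row contraction.
\<close>

subsection \<open>Square-summable sequences\<close>

text \<open>The inequality measures \<open>f0\<close> by the norm of \<open>\<phi> f0\<close>, so
  the natural domain of the row map consists of pairs \<open>(\<phi> f0, F)\<close>, whose first
  entry runs through the functions vanishing at \<open>0\<close>. No bounded operator and no
  abstract adjoint is constructed: the adjoint is written down explicitly on finite kernel
  combinations, and contractivity passes between the map and its adjoint by Cauchy--Schwarz in both
  directions. This costs nothing: a continuous function that vanishes there vanishes at
  \<open>0\<close> too, and the row and column of \<open>E\<close> at \<open>0\<close> are zero.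

  Schur complements replace an orthonormal basis of the space with kernel \<open>E\<close>, which
  would have to be built first. They deliver the components of \<open>b\<close> one at a time, hence
  only holomorphic componentwise, while the definition asks for differentiability in the norm of
  \<open>l2\<close>. Cauchy estimates that are uniform over unit combinations of components close
  this gap.\<close>

lemma suminf_cauchy_schwarz:
  fixes x y :: "nat \<Rightarrow> real"
  assumes "summable (\<lambda>n. (x n)\<^sup>2)" "summable (\<lambda>n. (y n)\<^sup>2)"
  shows "summable (\<lambda>n. \<bar>x n\<bar> * \<bar>y n\<bar>)"
    and "(\<Sum>n. \<bar>x n\<bar> * \<bar>y n\<bar>) \<le> sqrt (\<Sum>n. (x n)\<^sup>2) * sqrt (\<Sum>n. (y n)\<^sup>2)"
proof -
  have b: "(\<Sum>n<N. \<bar>x n\<bar> * \<bar>y n\<bar>) \<le> sqrt (\<Sum>n. (x n)\<^sup>2) * sqrt (\<Sum>n. (y n)\<^sup>2)" for N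
  proof -
    have "(\<Sum>n<N. \<bar>x n\<bar> * \<bar>y n\<bar>) \<le> L2_set x {..<N} * L2_set y {..<N}"
      by (rule L2_set_mult_ineq)
    also have "\<dots> \<le> sqrt (\<Sum>n. (x n)\<^sup>2) * sqrt (\<Sum>n. (y n)\<^sup>2)"
      unfolding L2_set_def
      by (intro mult_mono real_sqrt_le_mono sum_le_suminf assms) (auto simp: sum_nonneg suminf_nonneg assms)
    finally show ?thesis .
  qed
  show s: "summable (\<lambda>n. \<bar>x n\<bar> * \<bar>y n\<bar>)"
    by (rule summableI_nonneg_bounded[OF _ b]) auto
  show "(\<Sum>n. \<bar>x n\<bar> * \<bar>y n\<bar>) \<le> sqrt (\<Sum>n. (x n)\<^sup>2) * sqrt (\<Sum>n. (y n)\<^sup>2)"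
    by (rule suminf_le_const[OF s b])
qed

text \<open>Membership is derived along with the bound, because \<open>suminf\<close> of a divergent
  series is meaningless and a bound on \<open>l2_norm\<close> alone would say nothing.\<close>

lemma l2_norm_le:
  assumes "\<And>N. (\<Sum>n<N. (cmod (a n))\<^sup>2) \<le> C\<^sup>2" "0 \<le> C"
  shows "a \<in> l2" "l2_norm a \<le> C"
proof -
  have s: "summable (\<lambda>n. (cmod (a n))\<^sup>2)"
    by (rule summableI_nonneg_bounded[OF _ assms(1)]) auto
  then show "a \<in> l2" by (simp add: l2_def)
  have "(\<Sum>n. (cmod (a n))\<^sup>2) \<le> C\<^sup>2" by (rule suminf_le_const[OF s assms(1)])
  then show "l2_norm a \<le> C"
    unfolding l2_norm_def using assms(2) by (intro real_le_lsqrt) auto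
qed

lemma l2_norm_nonneg: "a \<in> l2 \<Longrightarrow> 0 \<le> l2_norm a"
  by (simp add: l2_norm_def l2_def suminf_nonneg)

lemma l2_inner_summable_norm:
  assumes "a \<in> l2" "b \<in> l2"
  shows "summable (\<lambda>n. cmod (a n * cnj (b n)))"
  using suminf_cauchy_schwarz(1)[of "\<lambda>n. cmod (a n)" "\<lambda>n. cmod (b n)"] assms
  by (simp add: l2_def norm_mult)

lemma l2_inner_sums:
  assumes "a \<in> l2" "b \<in> l2"
  shows "(\<lambda>n. a n * cnj (b n)) sums l2_inner a b"
  unfolding l2_inner_def
  using summable_norm_cancel[OF l2_inner_summable_norm[OF assms]] by (rule summable_sums)

lemma l2_inner_cauchy_schwarz:
  assumes "a \<in> l2" "b \<in> l2"
  shows "cmod (l2_inner a b) \<le> l2_norm a * l2_norm b"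
proof -
  have "cmod (l2_inner a b) \<le> (\<Sum>n. cmod (a n * cnj (b n)))"
    unfolding l2_inner_def by (rule summable_norm[OF l2_inner_summable_norm[OF assms]])
  also have "\<dots> \<le> l2_norm a * l2_norm b"
    using suminf_cauchy_schwarz(2)[of "\<lambda>n. cmod (a n)" "\<lambda>n. cmod (b n)"] assms
    by (simp add: l2_def l2_norm_def norm_mult)
  finally show ?thesis .
qed

lemma l2_inner_self:
  assumes "a \<in> l2"
  shows "l2_inner a a = of_real ((l2_norm a)\<^sup>2)"
proof -
  have "(\<lambda>n. of_real ((cmod (a n))\<^sup>2)) sums (of_real (\<Sum>n. (cmod (a n))\<^sup>2) :: complex)"
    by (subst sums_of_real_iff) (use assms in \<open>simp add: l2_def summable_sums\<close>)
  then have "(\<lambda>n. a n * cnj (a n)) sums (of_real (\<Sum>n. (cmod (a n))\<^sup>2) :: complex)"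
    by (simp only: complex_norm_square)
  moreover have "0 \<le> (\<Sum>n. (cmod (a n))\<^sup>2)"
    using assms by (simp add: l2_def suminf_nonneg)
  ultimately show ?thesis
    using sums_unique2[OF l2_inner_sums[OF assms assms]] by (simp add: l2_norm_def)
qed

lemma l2_norm_eq_0:
  assumes "a \<in> l2" "l2_norm a = 0"
  shows "a = (\<lambda>n. 0)"
proof -
  have "\<forall>n. (cmod (a n))\<^sup>2 = 0"
    using assms suminf_eq_zero_iff[of "\<lambda>n. (cmod (a n))\<^sup>2"] by (simp add: l2_def l2_norm_def)
  then show ?thesis by auto
qed

lemma l2_add:
  assumes "a \<in> l2" "b \<in> l2"
  shows "(\<lambda>n. a n + b n) \<in> l2"
proof -
  have "summable (\<lambda>n. 2 * ((cmod (a n))\<^sup>2 + (cmod (b n))\<^sup>2))"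
    using assms by (intro summable_mult summable_add) (auto simp: l2_def)
  moreover have "norm ((cmod (a n + b n))\<^sup>2) \<le> 2 * ((cmod (a n))\<^sup>2 + (cmod (b n))\<^sup>2)" for n
  proof -
    have "(cmod (a n + b n))\<^sup>2 \<le> (cmod (a n) + cmod (b n))\<^sup>2"
      by (intro power_mono norm_triangle_ineq) auto
    then show ?thesis
      using zero_le_power2[of "cmod (a n) - cmod (b n)"] by (simp add: power2_eq_square algebra_simps)
  qed
  ultimately show ?thesis
    unfolding l2_def mem_Collect_eq by (rule summable_comparison_test'[where N = 0])
qed

lemma l2_scale: "a \<in> l2 \<Longrightarrow> (\<lambda>n. c * a n) \<in> l2"
  by (simp add: l2_def norm_mult power_mult_distrib summable_mult)

lemma l2_diff:
  assumes "a \<in> l2" "b \<in> l2"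
  shows "(\<lambda>n. a n - b n) \<in> l2"
  using l2_add[OF assms(1) l2_scale[OF assms(2), of "-1"]] by simp

section \<open>Analytic functions with values in square-summable sequences\<close>

lemma l2_analyticD: "l2_analytic u \<Longrightarrow> z \<in> disc \<Longrightarrow> u z \<in> l2"
  by (simp add: l2_analytic_def)

text \<open>Pairing with a fixed \<open>v\<close> is linear and bounded, so norm convergence of the
  difference quotients of \<open>u\<close> passes to the scalar function; its derivative is
  \<open>l2_inner d v\<close>.\<close>

lemma l2_inner_holomorphic:
  assumes u: "l2_analytic u" and v: "v \<in> l2"
  shows "(\<lambda>z. l2_inner (u z) v) holomorphic_on disc"
  unfolding holomorphic_on_open[OF open_ball]
proof
  fix z assume z: "z \<in> disc"
  obtain d where d: "d \<in> l2"
    and lim: "((\<lambda>w. l2_norm (\<lambda>n. (u w n - u z n) / (w - z) - d n)) \<longlongrightarrow> 0) (at z)"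
    using u z unfolding l2_analytic_def by blast
  have "\<forall>\<^sub>F w in at z. w \<in> disc"
    using z by (metis open_ball eventually_at_in_open' )
  moreover have "cmod ((l2_inner (u w) v - l2_inner (u z) v) / (w - z) - l2_inner d v)
      \<le> l2_norm (\<lambda>n. (u w n - u z n) / (w - z) - d n) * l2_norm v" if w: "w \<in> disc" for w
  proof -
    let ?r = "\<lambda>n. (u w n - u z n) / (w - z) - d n"
    have ul: "u w \<in> l2" "u z \<in> l2" using l2_analyticD[OF u] w z by auto
    have "?r \<in> l2"
      using l2_diff[OF l2_scale[OF l2_diff[OF ul], of "1 / (w - z)"] d] by simp
    note rl = this
    have "(\<lambda>n. (u w n * cnj (v n) - u z n * cnj (v n)) / (w - z) - d n * cnj (v n))
        sums ((l2_inner (u w) v - l2_inner (u z) v) / (w - z) - l2_inner d v)"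
      by (intro sums_diff sums_divide l2_inner_sums ul v d)
    then have "(\<lambda>n. ?r n * cnj (v n))
        sums ((l2_inner (u w) v - l2_inner (u z) v) / (w - z) - l2_inner d v)"
      by (simp add: algebra_simps diff_divide_distrib)
    then have "l2_inner ?r v = (l2_inner (u w) v - l2_inner (u z) v) / (w - z) - l2_inner d v"
      by (simp add: l2_inner_def sums_iff)
    then show ?thesis using l2_inner_cauchy_schwarz[OF rl v] by simp
  qed
  ultimately have "\<forall>\<^sub>F w in at z. cmod ((l2_inner (u w) v - l2_inner (u z) v) / (w - z) - l2_inner d v)
      \<le> l2_norm (\<lambda>n. (u w n - u z n) / (w - z) - d n) * l2_norm v"
    by (rule eventually_mono)
  then have "((\<lambda>w. (l2_inner (u w) v - l2_inner (u z) v) / (w - z) - l2_inner d v) \<longlongrightarrow> 0) (at z)"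
    by (rule Lim_null_comparison) (rule tendsto_mult_left_zero[OF lim])
  then have "((\<lambda>z. l2_inner (u z) v) has_field_derivative l2_inner d v) (at z)"
    unfolding has_field_derivative_iff by (rule LIM_zero_cancel)
  then show "\<exists>f'. ((\<lambda>z. l2_inner (u z) v) has_field_derivative f') (at z)" ..
qed

text \<open>The constants depend on \<open>M\<close> and \<open>z\<close> but not on
  \<open>f\<close>, which allows the same bounds for all unit combinations of components at once. A
  third of the distance to the circle is taken for \<open>r\<close> so that the closed disc of
  radius \<open>r\<close> about any point of \<open>ball z r\<close> stays inside the unit
  disc.\<close>

lemma bounded_holomorphic_remainder:
  assumes f: "f holomorphic_on disc" and M: "\<And>w. w \<in> disc \<Longrightarrow> cmod (f w) \<le> M"
    and z: "z \<in> disc" and r: "r = (1 - cmod z) / 3"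
  shows "cmod (deriv f z) \<le> M / r"
    and "w \<in> ball z r \<Longrightarrow> cmod (f w - f z - deriv f z * (w - z)) \<le> 2 * M / r\<^sup>2 * (cmod (w - z))\<^sup>2"
proof -
  have r0: "0 < r" using z r by simp
  have sub: "cball x r \<subseteq> disc" if "x \<in> ball z r" for x
  proof
    fix y assume "y \<in> cball x r"
    then have "dist x y \<le> r" "dist z x < r" "dist 0 z = 1 - 3 * r" using that r by auto
    then show "y \<in> disc" using dist_triangle[of 0 y x] dist_triangle[of 0 x z] r0 by simp
  qed
  have cau: "cmod ((deriv ^^ n) f x) \<le> fact n * M / r ^ n" if "x \<in> ball z r" for x n
  proof (rule Cauchy_inequality)
    show "f holomorphic_on ball x r" "continuous_on (cball x r) f"
      using sub[OF that] f holomorphic_on_subset holomorphic_on_imp_continuous_on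
      by (meson ball_subset_cball subset_trans)+
    show "cmod (f y) \<le> M" if "cmod (x - y) = r" for y
      using M sub[OF \<open>x \<in> ball z r\<close>] that by (auto simp: dist_norm)
  qed (use r0 in auto)
  show "cmod (deriv f z) \<le> M / r" using cau[of z 1] r0 by simp
  assume w: "w \<in> ball z r"
  have fh: "f holomorphic_on ball z r"
    using f sub[of z] r0 by (meson ball_subset_cball centre_in_ball holomorphic_on_subset subset_trans)
  have d: "((deriv ^^ i) f has_field_derivative (deriv ^^ Suc i) f x) (at x within ball z r)"
    if "x \<in> ball z r" for i x
    using holomorphic_derivI[OF holomorphic_higher_deriv[OF fh open_ball, of i] open_ball that]
    by (simp add: has_field_derivative_at_within)
  \<comment> \<open>The factor \<open>2\<close> is the \<open>fact 2\<close> of Cauchy's estimate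
    for the second derivative; the Taylor remainder of order one divides only by
    \<open>fact 1\<close>.\<close>
  have B: "cmod ((deriv ^^ Suc 1) f x) \<le> 2 * M / r\<^sup>2" if "x \<in> ball z r" for x
    using cau[OF that, of 2] by (simp add: numeral_2_eq_2)
  have "cmod (f w - (\<Sum>i\<le>1. (deriv ^^ i) f z * (w - z) ^ i / fact i))
      \<le> (2 * M / r\<^sup>2) * cmod (w - z) ^ Suc 1 / fact 1"
    using complex_Taylor[OF convex_ball d B _ w, of z] r0 by simp
  then show "cmod (f w - f z - deriv f z * (w - z)) \<le> 2 * M / r\<^sup>2 * (cmod (w - z))\<^sup>2"
    by (simp add: power2_eq_square diff_diff_eq)
qed

text \<open>Duality upgrades bounds on scalar analytic functions to the norm of \<^term>\<open>l2\<close>.\<close>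

lemma sum_sq_le_of_dual:
  fixes x :: "nat \<Rightarrow> complex"
  assumes "\<And>c. (\<Sum>n<N. (cmod (c n))\<^sup>2) \<le> 1 \<Longrightarrow> cmod (\<Sum>n<N. c n * x n) \<le> C" and "0 \<le> C"
  shows "(\<Sum>n<N. (cmod (x n))\<^sup>2) \<le> C\<^sup>2"
proof -
  define s where "s = sqrt (\<Sum>n<N. (cmod (x n))\<^sup>2)"
  have s2: "s\<^sup>2 = (\<Sum>n<N. (cmod (x n))\<^sup>2)" by (simp add: s_def sum_nonneg)
  have s0: "s \<ge> 0" by (simp add: s_def sum_nonneg)
  show ?thesis
  proof (cases "s = 0")
    case False
    \<comment> \<open>The normalized conjugate of \<open>x\<close> is the unit vector at which the
      pairing attains the value \<open>s\<close>.\<close>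
    have "(\<Sum>n<N. (cmod (cnj (x n) / s))\<^sup>2) = (\<Sum>n<N. (cmod (x n))\<^sup>2) / s\<^sup>2"
      by (simp add: norm_divide power_divide sum_divide_distrib)
    then have "(\<Sum>n<N. (cmod (cnj (x n) / s))\<^sup>2) \<le> 1"
      using s2 False by simp
    then have "cmod (\<Sum>n<N. cnj (x n) / s * x n) \<le> C" by (rule assms(1))
    moreover have "(\<Sum>n<N. cnj (x n) / s * x n) = of_real (s\<^sup>2) / s"
      unfolding s2 of_real_sum sum_divide_distrib complex_norm_square
      by (intro sum.cong refl) (simp del: of_real_power add: complex_norm_square mult.commute)
    ultimately have "s \<le> C" using s0 False by (simp add: power2_eq_square)
    then show ?thesis using s2 s0 by (metis power_mono)
  qed (use s2 in simp)
qed

text \<open>For a unit vector \<open>c\<close>, Cauchy--Schwarz bounds the scalar function with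
  value \<open>\<Sum>n<N. c n * b w n\<close> by \<open>1\<close>, so its derivative and its
  quadratic Taylor remainder are controlled independently of \<open>c\<close> and \<open>N\<close>.
  Duality then puts the componentwise derivative \<open>d\<close> into \<open>l2\<close> and makes
  the error of the difference quotient \<open>O(|w - z|)\<close> in norm.\<close>

lemma l2_analyticI_bounded:
  assumes hol: "\<And>n. (\<lambda>z. b z n) holomorphic_on disc"
    and bd: "\<And>z N. z \<in> disc \<Longrightarrow> (\<Sum>n<N. (cmod (b z n))\<^sup>2) \<le> 1"
  shows "l2_analytic b"
  unfolding l2_analytic_def
proof (intro conjI ballI)
  fix z assume z: "z \<in> disc"
  show "b z \<in> l2" using l2_norm_le(1)[of "b z" 1] bd[OF z] by simp
next
  fix z assume z: "z \<in> disc"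
  define r where "r = (1 - cmod z) / 3"
  have r0: "0 < r" using z r_def by simp
  define d where "d n = deriv (\<lambda>z. b z n) z" for n
  have comb: "cmod (\<Sum>n<N. c n * d n) \<le> 1 / r"
       "w \<in> ball z r \<Longrightarrow> cmod (\<Sum>n<N. c n * (b w n - b z n - d n * (w - z))) \<le> 2 / r\<^sup>2 * (cmod (w - z))\<^sup>2"
    if c: "(\<Sum>n<N. (cmod (c n))\<^sup>2) \<le> 1" for c N w
  proof -
    let ?f = "\<lambda>w. \<Sum>n<N. c n * b w n"
    have hf: "?f holomorphic_on disc" by (intro holomorphic_intros hol)
    have bf: "cmod (?f w) \<le> 1" if "w \<in> disc" for w
    proof -
      have "cmod (?f w) \<le> (\<Sum>n<N. \<bar>cmod (c n)\<bar> * \<bar>cmod (b w n)\<bar>)"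
        by (rule order_trans[OF norm_sum]) (simp add: norm_mult)
      also have "\<dots> \<le> L2_set (\<lambda>n. cmod (c n)) {..<N} * L2_set (\<lambda>n. cmod (b w n)) {..<N}"
        by (rule L2_set_mult_ineq)
      also have "\<dots> \<le> 1 * 1"
        using c bd[OF that, of N] by (intro mult_mono) (auto simp: L2_set_def sum_nonneg)
      finally show ?thesis by simp
    qed
    have df: "deriv ?f z = (\<Sum>n<N. c n * d n)"
      unfolding d_def
      by (intro DERIV_imp_deriv DERIV_sum DERIV_cmult holomorphic_derivI[OF hol open_ball z])
    show "cmod (\<Sum>n<N. c n * d n) \<le> 1 / r"
      using bounded_holomorphic_remainder(1)[OF hf bf z r_def] by (simp add: df)
    show "cmod (\<Sum>n<N. c n * (b w n - b z n - d n * (w - z))) \<le> 2 / r\<^sup>2 * (cmod (w - z))\<^sup>2"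
      if "w \<in> ball z r"
      using bounded_holomorphic_remainder(2)[OF hf bf z r_def that]
      by (simp add: df sum_subtractf right_diff_distrib sum_distrib_right mult.assoc)
  qed
  have "d \<in> l2"
    using sum_sq_le_of_dual[OF comb(1)] r0 by (intro l2_norm_le(1)[where C = "1 / r"]) (auto intro: less_imp_le)
  moreover have "((\<lambda>w. l2_norm (\<lambda>n. (b w n - b z n) / (w - z) - d n)) \<longlongrightarrow> 0) (at z)"
  proof (rule Lim_null_comparison)
    show "((\<lambda>w. 2 / r\<^sup>2 * cmod (w - z)) \<longlongrightarrow> 0) (at z)"
      using r0 by (auto intro!: tendsto_eq_intros)
    have "\<forall>\<^sub>F w in at z. w \<in> ball z r - {z}"
      using r0 by (intro eventually_at_in_open) auto
    then show "\<forall>\<^sub>F w in at z. norm (l2_norm (\<lambda>n. (b w n - b z n) / (w - z) - d n)) \<le> 2 / r\<^sup>2 * cmod (w - z)"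
    proof eventually_elim
      case (elim w)
      let ?q = "\<lambda>n. (b w n - b z n) / (w - z) - d n"
      have ne: "w \<noteq> z" and wb: "w \<in> ball z r" using elim by auto
      have "(\<Sum>n<N. (cmod (?q n))\<^sup>2) \<le> (2 / r\<^sup>2 * cmod (w - z))\<^sup>2" for N
      proof (rule sum_sq_le_of_dual)
        fix c :: "nat \<Rightarrow> complex" assume "(\<Sum>n<N. (cmod (c n))\<^sup>2) \<le> 1"
        from comb(2)[OF this wb]
        have "cmod (\<Sum>n<N. c n * (b w n - b z n - d n * (w - z))) / cmod (w - z) \<le> 2 / r\<^sup>2 * cmod (w - z)"
          using ne by (simp add: field_simps power2_eq_square)
        moreover have "(\<Sum>n<N. c n * ?q n) = (\<Sum>n<N. c n * (b w n - b z n - d n * (w - z))) / (w - z)"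
          unfolding sum_divide_distrib using ne by (intro sum.cong) (auto simp: field_simps)
        ultimately show "cmod (\<Sum>n<N. c n * ?q n) \<le> 2 / r\<^sup>2 * cmod (w - z)"
          by (simp add: norm_divide)
      qed auto
      from l2_norm_le[OF this] show ?case using l2_norm_nonneg[of ?q] by simp
    qed
  qed
  ultimately show "\<exists>d\<in>l2. ((\<lambda>w. l2_norm (\<lambda>n. (b w n - b z n) / (w - z) - d n)) \<longlongrightarrow> 0) (at z)" by blast
qed

subsection \<open>Positive kernels on the disc\<close>

lemma psd_kernel_pair:
  assumes E: "psd_kernel E" and zw: "z \<in> disc" "w \<in> disc" "z \<noteq> w"
  defines "q \<equiv> \<lambda>a b. a * cnj a * E z z + a * cnj b * E z w + b * cnj a * E w z + b * cnj b * E w w"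
  shows "Im (q a b) = 0" "0 \<le> Re (q a b)"
proof -
  have "(\<Sum>x\<in>{z, w}. \<Sum>y\<in>{z, w}. (if x = z then a else b) * cnj (if y = z then a else b) * E x y) = q a b"
    using zw(3) by (simp add: q_def)
  moreover have "{z, w} \<subseteq> disc" using zw by simp
  ultimately show "Im (q a b) = 0" "0 \<le> Re (q a b)"
    using E[unfolded psd_kernel_def, rule_format, of "{z, w}" "\<lambda>x. if x = z then a else b"]
    by (auto simp: complex_is_Real_iff)
qed

lemma psd_kernel_diag:
  assumes E: "psd_kernel E" and z: "z \<in> disc"
  shows "0 \<le> Re (E z z)" "E z z = of_real (Re (E z z))"
proof -
  have "E z z \<in> \<real> \<and> 0 \<le> Re (E z z)"
    using E[unfolded psd_kernel_def, rule_format, of "{z}" "\<lambda>_. 1"] z by simp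
  then show "0 \<le> Re (E z z)" "E z z = of_real (Re (E z z))" by simp_all
qed

text \<open>The definition only asks the quadratic form to be real and nonnegative; over the complex
  numbers realness already forces Hermitian symmetry.\<close>

lemma psd_kernel_hermitian:
  assumes E: "psd_kernel E" and zw: "z \<in> disc" "w \<in> disc"
  shows "E w z = cnj (E z w)"
proof (cases "z = w")
  case True
  then show ?thesis using psd_kernel_diag(2)[OF E zw(1)] by (metis complex_cnj_complex_of_real)
next
  case False
  note im = psd_kernel_pair(1)[OF E zw False]
  have "Im (E z z) = 0" "Im (E w w) = 0"
    using psd_kernel_diag(2)[OF E zw(1)] psd_kernel_diag(2)[OF E zw(2)] by (metis Im_complex_of_real)+
  \<comment> \<open>The coefficients \<open>1, 1\<close> show that the imaginary parts are opposite,
    the coefficients \<open>1, \<i>\<close> that the real parts agree.\<close>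
  then show ?thesis using im[of 1 1] im[of 1 \<i>] by (simp add: complex_eq_iff)
qed

text \<open>With a zero diagonal entry at \<open>p\<close> the two-point form loses its quadratic
  term in the second coefficient, and a nonzero off-diagonal entry would drive it below
  zero.\<close>

lemma psd_kernel_null:
  assumes E: "psd_kernel E" and zp: "z \<in> disc" "p \<in> disc" and 0: "E p p = 0"
  shows "E z p = 0" "E p z = 0"
proof -
  show "E z p = 0"
  proof (rule ccontr)
    assume ne: "E z p \<noteq> 0"
    \<comment> \<open>Chosen so that the form below takes the value \<open>-1\<close>.\<close>
    define x where "x = (Re (E z z) + 1) / (2 * (cmod (E z p))\<^sup>2)"
    have "z \<noteq> p" using ne 0 by auto
    from psd_kernel_pair(2)[OF E zp this, of 1 "- of_real x * E z p"]
    have "0 \<le> Re (E z z) - 2 * x * (cmod (E z p))\<^sup>2"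
      unfolding cmod_power2 by (simp add: 0 psd_kernel_hermitian[OF E zp] power2_eq_square algebra_simps)
    then show False using ne by (simp add: x_def)
  qed
  then show "E p z = 0" using psd_kernel_hermitian[OF E zp] by simp
qed

text \<open>If \<open>E p p = 0\<close> the quotient is \<open>0\<close>, which is right because then \<open>E p\<close> vanishes.\<close>

definition schur_complement ::
  "complex \<Rightarrow> (complex \<Rightarrow> complex \<Rightarrow> complex) \<Rightarrow> complex \<Rightarrow> complex \<Rightarrow> complex" where
  "schur_complement p E = (\<lambda>z w. E z w - E z p * E p w / E p p)"

text \<open>The form of the Schur complement at \<open>c\<close> equals the form of \<open>E\<close>
  at \<open>c\<close> with the extra mass \<open>t\<close> at \<open>p\<close>, where
  \<open>t\<close> minimizes the form of \<open>E\<close>. If \<open>E p p = 0\<close>, then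
  \<open>t = 0\<close> by division by zero, and the cross terms vanish because
  \<open>s = 0\<close>.\<close>

lemma psd_schur_complement:
  assumes E: "psd_kernel E" and p: "p \<in> disc"
  shows "psd_kernel (schur_complement p E)"
  unfolding psd_kernel_def
proof (intro allI impI)
  fix X :: "complex set" and c :: "complex \<Rightarrow> complex"
  assume X: "finite X \<and> X \<subseteq> disc"
  define s where "s = (\<Sum>z\<in>X. c z * E z p)"
  define A where "A z = (\<Sum>w\<in>X. cnj (c w) * E z w)" for z
  define S where "S = (\<Sum>z\<in>X. c z * A z)"
  define t where "t = - s / E p p"
  \<comment> \<open>The mass is added to the coefficient rather than put in its place, since
    \<open>p\<close> may already belong to \<open>X\<close>.\<close>
  define d where "d x = (if x \<in> X then c x else 0) + (if x = p then t else 0)" for x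
  have red: "(\<Sum>x\<in>insert p X. f (d x) * g x) = (\<Sum>x\<in>X. f (c x) * g x) + f t * g p"
    if f: "f 0 = 0" "\<And>x y. f (x + y) = f x + f y" for f g :: "complex \<Rightarrow> complex"
  proof -
    have "(\<Sum>x\<in>insert p X. f (d x) * g x)
        = (\<Sum>x\<in>insert p X. if x \<in> X then f (c x) * g x else 0) + (\<Sum>x\<in>insert p X. if x = p then f t * g x else 0)"
      unfolding sum.distrib[symmetric] by (rule sum.cong) (auto simp: d_def f algebra_simps)
    moreover have "(\<Sum>x\<in>insert p X. if x \<in> X then f (c x) * g x else 0) = (\<Sum>x\<in>X. f (c x) * g x)"
      using X by (intro sum.mono_neutral_cong_right) auto
    ultimately show ?thesis using X by simp
  qed
  have epp: "cnj (E p p) = E p p" using psd_kernel_hermitian[OF E p p] by simp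
  have Ap: "A p = cnj s"
    unfolding A_def s_def cnj_sum complex_cnj_mult
    using psd_kernel_hermitian[OF E _ p] X by (intro sum.cong refl) auto
  have s0: "s = 0" if "E p p = 0"
    unfolding s_def using psd_kernel_null(1)[OF E _ p that] X by (intro sum.neutral) auto
  have "(\<Sum>z\<in>insert p X. \<Sum>w\<in>insert p X. d z * cnj (d w) * E z w)
      = (\<Sum>z\<in>insert p X. d z * (\<Sum>w\<in>insert p X. cnj (d w) * E z w))"
    by (simp add: sum_distrib_left mult.assoc)
  also have "\<dots> = (\<Sum>z\<in>insert p X. d z * (A z + cnj t * E z p))"
    using red[of cnj] by (simp add: A_def)
  also have "\<dots> = (\<Sum>z\<in>X. c z * (A z + cnj t * E z p)) + t * (A p + cnj t * E p p)"
    by (rule red[of "\<lambda>x. x"]) auto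
  also have "\<dots> = S + cnj t * s + t * (A p + cnj t * E p p)"
    by (simp add: S_def s_def sum.distrib sum_distrib_left algebra_simps)
  also have "\<dots> = S - s * A p / E p p"
    using s0 epp by (cases "E p p = 0") (auto simp: t_def Ap field_simps)
  also have "\<dots> = (\<Sum>z\<in>X. \<Sum>w\<in>X. c z * cnj (c w) * schur_complement p E z w)"
  proof -
    have "(\<Sum>z\<in>X. \<Sum>w\<in>X. c z * cnj (c w) * schur_complement p E z w)
        = (\<Sum>z\<in>X. c z * (\<Sum>w\<in>X. cnj (c w) * E z w - E z p / E p p * (cnj (c w) * E p w)))"
      unfolding sum_distrib_left schur_complement_def
      by (intro sum.cong refl) (simp add: algebra_simps)
    also have "\<dots> = (\<Sum>z\<in>X. c z * (A z - E z p / E p p * A p))"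
      by (simp only: sum_subtractf sum_distrib_left[symmetric] A_def)
    also have "\<dots> = (\<Sum>z\<in>X. c z * A z - c z * E z p * (A p / E p p))"
      by (intro sum.cong refl) (simp add: right_diff_distrib)
    also have "\<dots> = S - s * (A p / E p p)"
      by (simp only: sum_subtractf sum_distrib_right[symmetric] S_def s_def)
    also have "\<dots> = S - s * A p / E p p" by simp
    finally show ?thesis ..
  qed
  finally have eq: "(\<Sum>z\<in>insert p X. \<Sum>w\<in>insert p X. d z * cnj (d w) * E z w)
      = (\<Sum>z\<in>X. \<Sum>w\<in>X. c z * cnj (c w) * schur_complement p E z w)" .
  have "finite (insert p X) \<and> insert p X \<subseteq> disc" using X p by simp
  with E have "(\<Sum>z\<in>insert p X. \<Sum>w\<in>insert p X. d z * cnj (d w) * E z w) \<in> \<real> \<and>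
      0 \<le> Re (\<Sum>z\<in>insert p X. \<Sum>w\<in>insert p X. d z * cnj (d w) * E z w)"
    unfolding psd_kernel_def by blast
  then show "(\<Sum>z\<in>X. \<Sum>w\<in>X. c z * cnj (c w) * schur_complement p E z w) \<in> \<real> \<and>
      0 \<le> Re (\<Sum>z\<in>X. \<Sum>w\<in>X. c z * cnj (c w) * schur_complement p E z w)"
    unfolding eq .
qed

section \<open>Cholesky factorization of a positive kernel along a dense sequence of pivots\<close>

primrec schur_seq ::
  "(nat \<Rightarrow> complex) \<Rightarrow> (complex \<Rightarrow> complex \<Rightarrow> complex) \<Rightarrow> nat \<Rightarrow> complex \<Rightarrow> complex \<Rightarrow> complex" where
  "schur_seq p E 0 = E"
| "schur_seq p E (Suc n) = schur_complement (p n) (schur_seq p E n)"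

lemma psd_schur_seq:
  assumes "psd_kernel E" "\<And>n. p n \<in> disc"
  shows "psd_kernel (schur_seq p E n)"
proof (induction n)
  case (Suc n)
  show ?case unfolding schur_seq.simps by (rule psd_schur_complement[OF Suc assms(2)])
qed (simp add: assms(1))

lemma schur_seq_holomorphic:
  assumes "\<And>w. w \<in> disc \<Longrightarrow> (\<lambda>z. E z w) holomorphic_on disc" "\<And>n. p n \<in> disc" "w \<in> disc"
  shows "(\<lambda>z. schur_seq p E n z w) holomorphic_on disc"
  using assms(3)
proof (induction n arbitrary: w)
  case (Suc n)
  have "(\<lambda>z. schur_seq p E n z w - schur_seq p E n z (p n) *
      (schur_seq p E n (p n) w / schur_seq p E n (p n) (p n))) holomorphic_on disc"
    by (intro holomorphic_intros Suc assms)
  then show ?case by (simp add: schur_complement_def)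
qed (simp add: assms(1))

text \<open>Elimination at \<open>p j\<close> clears the row of \<open>p j\<close>. Each later
  complement subtracts a multiple of its pivot column, whose entry at \<open>p j\<close> is already
  zero, so the row stays cleared.\<close>

lemma schur_seq_null:
  assumes "psd_kernel E" "\<And>n. p n \<in> disc" "w \<in> disc" "j < n"
  shows "schur_seq p E n (p j) w = 0"
  using assms(3,4)
proof (induction n arbitrary: w)
  case (Suc n)
  show ?case
  proof (cases "j = n")
    case True
    then show ?thesis
      using psd_kernel_null(2)[OF psd_schur_seq[of E p n, OF assms(1,2)] Suc.prems(1), of "p n"] assms(2)
      by (cases "schur_seq p E n (p n) (p n) = 0") (auto simp: schur_complement_def)
  next
    case False
    then show ?thesis using Suc assms(2) by (simp add: schur_complement_def)
  qed
qed simp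

text \<open>The components of \<open>b\<close> are the normalized pivot columns. Telescoping shows
  that their partial sums equal \<open>E\<close> minus a positive remainder, which on the diagonal
  bounds them by \<open>1\<close>; off the diagonal the remainder is eventually zero once the first
  argument is a pivot.\<close>

lemma psd_kernel_factorization:
  assumes E: "psd_kernel E"
    and hol: "\<And>w. w \<in> disc \<Longrightarrow> (\<lambda>z. E z w) holomorphic_on disc"
    and le1: "\<And>z. z \<in> disc \<Longrightarrow> Re (E z z) \<le> 1"
  shows "\<exists>b. analytic_row_contraction b \<and> (\<forall>z\<in>disc. \<forall>w\<in>disc. E z w = l2_inner (b z) (b w))"
proof -
  obtain D where D: "countable D" "D \<subseteq> disc" "disc \<subseteq> closure D"
    using separable by blast
  have Dne: "D \<noteq> {}" using D(3) by auto
  define p where "p = from_nat_into D"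
  have p: "p n \<in> disc" for n using from_nat_into[OF Dne] D(2) unfolding p_def by blast
  define Es where "Es = schur_seq p E"
  have psd: "psd_kernel (Es n)" for n unfolding Es_def by (rule psd_schur_seq[OF E p])
  define r where "r n = sqrt (Re (Es n (p n) (p n)))" for n
  \<comment> \<open>If \<open>r n = 0\<close> the component is \<open>0\<close> by division by zero,
    in agreement with a Schur complement that then changes nothing.\<close>
  define b where "b z n = Es n z (p n) / of_real (r n)" for z n
  have step: "Es n z w - Es (Suc n) z w = b z n * cnj (b w n)" if w: "w \<in> disc" for n z w
  proof -
    have "Es n (p n) w = cnj (Es n w (p n))" by (rule psd_kernel_hermitian[OF psd w p])
    moreover have "of_real (r n) * of_real (r n) = Es n (p n) (p n)"
      using psd_kernel_diag[OF psd p, of n] by (simp add: r_def flip: of_real_mult)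
    ultimately show ?thesis by (simp add: b_def Es_def schur_complement_def)
  qed
  have tele: "(\<Sum>m<n. b z m * cnj (b w m)) = E z w - Es n z w" if "w \<in> disc" for n z w
  proof (induction n)
    case (Suc n)
    then show ?case using step[OF that, of n z] by (simp flip: step[OF that])
  qed (simp add: Es_def)
  have bd: "(\<Sum>m<n. (cmod (b z m))\<^sup>2) \<le> 1" if z: "z \<in> disc" for z n
  proof -
    have "complex_of_real (\<Sum>m<n. (cmod (b z m))\<^sup>2) = E z z - Es n z z"
      unfolding tele[OF z, symmetric] of_real_sum complex_norm_square ..
    then have "(\<Sum>m<n. (cmod (b z m))\<^sup>2) = Re (E z z) - Re (Es n z z)"
      by (simp add: complex_eq_iff)
    then show ?thesis using le1[OF z] psd_kernel_diag(1)[OF psd z, of n] by simp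
  qed
  have bl2: "b z \<in> l2" "l2_norm (b z) \<le> 1" if "z \<in> disc" for z
    using l2_norm_le[of "b z" 1] bd[OF that] by auto
  have "(\<lambda>z. b z n) holomorphic_on disc" for n
  proof -
    have "(\<lambda>z. Es n z (p n) * (1 / of_real (r n))) holomorphic_on disc"
      unfolding Es_def by (intro holomorphic_intros schur_seq_holomorphic hol p)
    then show ?thesis by (simp add: b_def)
  qed
  then have an: "l2_analytic b" by (rule l2_analyticI_bounded) (rule bd)
  have "E z w = l2_inner (b z) (b w)" if z: "z \<in> disc" and w: "w \<in> disc" for z w
  proof -
    \<comment> \<open>The point \<open>w\<close> is arbitrary but fixed: only the first argument has
      to run through the dense set, and \<open>G\<close> is continuous in it.\<close>
    define G where "G z = E z w - l2_inner (b z) (b w)" for z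
    have "G holomorphic_on disc"
      unfolding G_def by (intro holomorphic_intros hol w l2_inner_holomorphic an bl2)
    then have cont: "continuous_on disc G" by (rule holomorphic_on_imp_continuous_on)
    have GD: "G x = 0" if xD: "x \<in> D" for x
    proof -
      obtain j where "p j = x" using from_nat_into_surj[OF D(1) xD] unfolding p_def by blast
      note j = this[symmetric]
      have "(\<lambda>n. E x w - Es n x w) \<longlonglongrightarrow> l2_inner (b x) (b w)"
        using l2_inner_sums[OF bl2(1)[OF p] bl2(1)[OF w], of j] unfolding sums_def tele[OF w] j .
      moreover have "\<forall>\<^sub>F n in sequentially. E x w - Es n x w = E x w"
      proof (rule eventually_mono[OF eventually_gt_at_top[of j]])
        fix n assume "j < n"
        then have "Es n x w = 0" unfolding Es_def j by (rule schur_seq_null[OF E p w])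
        then show "E x w - Es n x w = E x w" by simp
      qed
      ultimately have "(\<lambda>n. E x w) \<longlonglongrightarrow> l2_inner (b x) (b w)" by (rule Lim_transform_eventually)
      then show ?thesis by (simp add: G_def LIMSEQ_const_iff)
    qed
    obtain x where x: "\<And>n. x n \<in> D" "x \<longlonglongrightarrow> z" using D(3) z closure_sequential by blast
    have "(\<lambda>n. G (x n)) \<longlonglongrightarrow> G z"
      using continuous_on_tendsto_compose[OF cont x(2) z] x(1) D(2) by (simp add: subset_eq)
    then have "G z = 0" using GD x(1) by (simp add: LIMSEQ_const_iff)
    then show ?thesis by (simp add: G_def)
  qed
  then show ?thesis using an bl2(2) unfolding analytic_row_contraction_def by blast
qed

text \<open>Componentwise the form is the squared modulus of
  \<open>\<Sum>z\<in>X. c z * b z n\<close>, and these are summed over \<open>n\<close>.\<close>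

lemma psd_kernel_l2_inner:
  assumes X: "finite X" and b: "\<And>z. z \<in> X \<Longrightarrow> b z \<in> l2"
  shows "0 \<le> Re (\<Sum>z\<in>X. \<Sum>w\<in>X. c z * cnj (c w) * l2_inner (b z) (b w))"
proof -
  have "(\<lambda>n. \<Sum>z\<in>X. \<Sum>w\<in>X. c z * cnj (c w) * (b z n * cnj (b w n)))
      sums (\<Sum>z\<in>X. \<Sum>w\<in>X. c z * cnj (c w) * l2_inner (b z) (b w))"
    by (intro sums_sum sums_mult l2_inner_sums b)
  moreover have "(\<Sum>z\<in>X. \<Sum>w\<in>X. c z * cnj (c w) * (b z n * cnj (b w n)))
      = of_real ((cmod (\<Sum>z\<in>X. c z * b z n))\<^sup>2)" for n
    unfolding complex_norm_square cnj_sum sum_product by (intro sum.cong refl) simp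
  ultimately have "(\<lambda>n. complex_of_real ((cmod (\<Sum>z\<in>X. c z * b z n))\<^sup>2))
      sums (\<Sum>z\<in>X. \<Sum>w\<in>X. c z * cnj (c w) * l2_inner (b z) (b w))"
    by simp
  from sums_le[OF _ sums_zero sums_Re[OF this]] show ?thesis by simp
qed

subsection \<open>Reproducing kernel Hilbert spaces on the disc\<close>

locale rkhs =
  fixes H :: "cfun set" and ip :: "cfun \<Rightarrow> cfun \<Rightarrow> complex" and K :: "complex \<Rightarrow> complex \<Rightarrow> complex"
  assumes hilbert: "hilbert_analytic_space H ip" and kernel: "has_reproducing_kernel H ip K"
begin

lemma ipfs: "inner_product_function_space H ip"
  using hilbert by (simp add: hilbert_analytic_space_def)

lemma zero_outside: "f \<in> H \<Longrightarrow> z \<notin> disc \<Longrightarrow> f z = 0"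
  and zero_mem: "(\<lambda>z. 0) \<in> H"
  and add_mem: "f \<in> H \<Longrightarrow> g \<in> H \<Longrightarrow> (\<lambda>z. f z + g z) \<in> H"
  and scale_mem: "f \<in> H \<Longrightarrow> (\<lambda>z. c * f z) \<in> H"
  and ip_add: "f \<in> H \<Longrightarrow> g \<in> H \<Longrightarrow> h \<in> H \<Longrightarrow> ip (\<lambda>z. f z + g z) h = ip f h + ip g h"
  and ip_scale: "f \<in> H \<Longrightarrow> g \<in> H \<Longrightarrow> ip (\<lambda>z. c * f z) g = c * ip f g"
  and ip_cnj: "f \<in> H \<Longrightarrow> g \<in> H \<Longrightarrow> ip g f = cnj (ip f g)"
  and ip_ge_0: "f \<in> H \<Longrightarrow> 0 \<le> Re (ip f f)"
  and ip_definite: "f \<in> H \<Longrightarrow> ip f f = 0 \<Longrightarrow> f = (\<lambda>z. 0)"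
  using ipfs unfolding inner_product_function_space_def by blast+

lemma diff_mem:
  assumes "f \<in> H" "g \<in> H"
  shows "(\<lambda>z. f z - g z) \<in> H"
  using add_mem[OF assms(1) scale_mem[OF assms(2), of "-1"]] by simp

lemma ip_diff:
  assumes "f \<in> H" "g \<in> H" "h \<in> H"
  shows "ip (\<lambda>z. f z - g z) h = ip f h - ip g h"
  using ip_add[OF assms(1) scale_mem[OF assms(2), of "-1"] assms(3)] ip_scale[OF assms(2,3), of "-1"]
  by simp

lemma ip_diff_right:
  assumes "f \<in> H" "g \<in> H" "h \<in> H"
  shows "ip h (\<lambda>z. f z - g z) = ip h f - ip h g"
  using ip_cnj[OF diff_mem[OF assms(1,2)] assms(3)] ip_cnj[OF assms(1,3)] ip_cnj[OF assms(2,3)] ip_diff[OF assms]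
  by simp

lemma ip_scale_right:
  assumes "f \<in> H" "g \<in> H"
  shows "ip g (\<lambda>z. c * f z) = cnj c * ip g f"
  using ip_cnj[OF scale_mem[OF assms(1)] assms(2), of c] ip_cnj[OF assms] ip_scale[OF assms, of c] by simp

lemma ip_zero: "g \<in> H \<Longrightarrow> ip (\<lambda>z. 0) g = 0"
  using ip_scale[OF zero_mem, of g 0] by simp

lemma lincomb:
  assumes "finite X" "\<And>x. x \<in> X \<Longrightarrow> f x \<in> H"
  shows lincomb_mem: "(\<lambda>z. \<Sum>x\<in>X. a x * f x z) \<in> H"
    and ip_lincomb: "g \<in> H \<Longrightarrow> ip (\<lambda>z. \<Sum>x\<in>X. a x * f x z) g = (\<Sum>x\<in>X. a x * ip (f x) g)"
proof -
  have "(\<lambda>z. \<Sum>x\<in>X. a x * f x z) \<in> H \<and>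
      (g \<in> H \<longrightarrow> ip (\<lambda>z. \<Sum>x\<in>X. a x * f x z) g = (\<Sum>x\<in>X. a x * ip (f x) g))"
    using assms
  proof (induction X)
    case empty
    then show ?case by (simp add: zero_mem ip_zero)
  next
    case (insert x X)
    have m: "f x \<in> H" "(\<lambda>z. \<Sum>x\<in>X. a x * f x z) \<in> H" using insert by auto
    show ?case
    proof (intro conjI impI)
      show "(\<lambda>z. \<Sum>x\<in>insert x X. a x * f x z) \<in> H"
        using add_mem[OF scale_mem[OF m(1), of "a x"] m(2)] insert.hyps by simp
      assume g: "g \<in> H"
      have "ip (\<lambda>z. a x * f x z + (\<Sum>x\<in>X. a x * f x z)) g = a x * ip (f x) g + (\<Sum>x\<in>X. a x * ip (f x) g)"
        unfolding ip_add[OF scale_mem[OF m(1)] m(2) g] ip_scale[OF m(1) g] using insert g by simp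
      then show "ip (\<lambda>z. \<Sum>x\<in>insert x X. a x * f x z) g = (\<Sum>x\<in>insert x X. a x * ip (f x) g)"
        using insert.hyps by simp
    qed
  qed
  then show "(\<lambda>z. \<Sum>x\<in>X. a x * f x z) \<in> H"
    and "g \<in> H \<Longrightarrow> ip (\<lambda>z. \<Sum>x\<in>X. a x * f x z) g = (\<Sum>x\<in>X. a x * ip (f x) g)" by auto
qed

lemma ip_lincomb_right:
  assumes "finite X" "\<And>x. x \<in> X \<Longrightarrow> f x \<in> H" "g \<in> H"
  shows "ip g (\<lambda>z. \<Sum>x\<in>X. a x * f x z) = (\<Sum>x\<in>X. cnj (a x) * ip g (f x))"
proof -
  have "ip g (\<lambda>z. \<Sum>x\<in>X. a x * f x z) = (\<Sum>x\<in>X. cnj (a x) * cnj (ip (f x) g))"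
    using ip_cnj[OF lincomb_mem[OF assms(1,2), where a = a] assms(3)] ip_lincomb[OF assms(1,2), where a = a and g = g] assms(3)
    by simp
  also have "\<dots> = (\<Sum>x\<in>X. cnj (a x) * ip g (f x))"
    by (intro sum.cong refl) (metis ip_cnj assms(2,3))
  finally show ?thesis .
qed

lemma hnorm_ge_0: "f \<in> H \<Longrightarrow> 0 \<le> hnorm ip f"
  by (simp add: hnorm_def ip_ge_0)

lemma hnorm_sq: "f \<in> H \<Longrightarrow> (hnorm ip f)\<^sup>2 = Re (ip f f)"
  by (simp add: hnorm_def ip_ge_0)

lemma ip_self:
  assumes "f \<in> H"
  shows "ip f f = of_real ((hnorm ip f)\<^sup>2)"
  using ip_cnj[OF assms assms] hnorm_sq[OF assms] by (simp add: complex_eq_iff)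

lemma hnorm_sq_diff:
  assumes "f \<in> H" "g \<in> H"
  shows "(hnorm ip (\<lambda>z. f z - c * g z))\<^sup>2
    = (hnorm ip f)\<^sup>2 - 2 * Re (cnj c * ip f g) + (cmod c)\<^sup>2 * (hnorm ip g)\<^sup>2"
proof -
  have cg: "(\<lambda>z. c * g z) \<in> H" by (rule scale_mem[OF assms(2)])
  have "ip (\<lambda>z. f z - c * g z) (\<lambda>z. f z - c * g z)
      = ip f f - cnj c * ip f g - (c * ip g f - c * (cnj c * ip g g))"
    by (simp only: ip_diff[OF assms(1) cg diff_mem[OF assms(1) cg]] ip_diff_right[OF assms(1) cg assms(1)]
        ip_diff_right[OF assms(1) cg cg] ip_scale[OF assms(2) assms(1)] ip_scale_right[OF assms(2) assms(1)]
        ip_scale[OF assms(2) cg] ip_scale_right[OF assms(2) assms(2)])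
  also have "\<dots> = ip f f - (cnj c * ip f g + cnj (cnj c * ip f g)) + c * cnj c * ip g g"
    using ip_cnj[OF assms] by (simp add: algebra_simps)
  also have "\<dots> = of_real ((hnorm ip f)\<^sup>2 - 2 * Re (cnj c * ip f g) + (cmod c)\<^sup>2 * (hnorm ip g)\<^sup>2)"
    unfolding complex_add_cnj ip_self[OF assms(1)] ip_self[OF assms(2)] complex_norm_square[symmetric] by simp
  finally show ?thesis
    unfolding hnorm_sq[OF diff_mem[OF assms(1) cg]] by (simp only: Re_complex_of_real)
qed

text \<open>For \<open>d = 0\<close> this is the Cauchy--Schwarz inequality; in general it says that an almost minimal \<open>g\<close>
  is almost orthogonal to \<open>s\<close>.\<close>

lemma ip_bound_of_minimal:
  assumes g: "g \<in> H" and s: "s \<in> H" and min: "\<And>c. d \<le> (hnorm ip (\<lambda>z. g z - c * s z))\<^sup>2"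
  shows "(cmod (ip g s))\<^sup>2 \<le> (hnorm ip s)\<^sup>2 * ((hnorm ip g)\<^sup>2 - d)"
proof (cases "hnorm ip s = 0")
  case True
  then have "s = (\<lambda>z. 0)" using ip_definite[OF s] ip_self[OF s] by simp
  then have "ip g s = 0" using ip_zero[OF g] ip_cnj[OF zero_mem g] by simp
  then show ?thesis by (simp add: True)
next
  case False
  \<comment> \<open>The coefficient of the orthogonal projection of \<open>g\<close> onto the line
    spanned by \<open>s\<close>.\<close>
  define t where "t = ip g s / of_real ((hnorm ip s)\<^sup>2)"
  have "cnj t * ip g s = of_real ((cmod (ip g s))\<^sup>2 / (hnorm ip s)\<^sup>2)"
    unfolding t_def of_real_divide complex_norm_square by (simp add: mult.commute)
  then have 1: "Re (cnj t * ip g s) = (cmod (ip g s))\<^sup>2 / (hnorm ip s)\<^sup>2" by (simp only: Re_complex_of_real)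
  have 2: "(cmod t)\<^sup>2 * (hnorm ip s)\<^sup>2 = (cmod (ip g s))\<^sup>2 / (hnorm ip s)\<^sup>2"
  proof -
    have "cmod t = cmod (ip g s) / (hnorm ip s)\<^sup>2"
      by (simp only: t_def norm_divide norm_of_real abs_power2)
    then show ?thesis using False by (simp add: power_divide power2_eq_square)
  qed
  have "d \<le> (hnorm ip g)\<^sup>2 - (cmod (ip g s))\<^sup>2 / (hnorm ip s)\<^sup>2"
    using min[of t] unfolding hnorm_sq_diff[OF g s] 1 2 by simp
  then have "(cmod (ip g s))\<^sup>2 / (hnorm ip s)\<^sup>2 \<le> (hnorm ip g)\<^sup>2 - d" by simp
  then show ?thesis using False by (simp add: divide_le_eq mult.commute)
qed

lemma cauchy_schwarz:
  assumes "f \<in> H" "g \<in> H"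
  shows "cmod (ip f g) \<le> hnorm ip f * hnorm ip g"
proof -
  have "(cmod (ip f g))\<^sup>2 \<le> (hnorm ip f * hnorm ip g)\<^sup>2"
    using ip_bound_of_minimal[OF assms, of 0] by (simp add: power_mult_distrib mult.commute)
  then show ?thesis
    by (rule power2_le_imp_le) (simp add: hnorm_ge_0 assms)
qed

lemma section_mem: "w \<in> disc \<Longrightarrow> kernel_section K w \<in> H"
  and reproducing: "w \<in> disc \<Longrightarrow> f \<in> H \<Longrightarrow> ip f (kernel_section K w) = f w"
  using kernel unfolding has_reproducing_kernel_def by blast+

lemma section_apply: "z \<in> disc \<Longrightarrow> kernel_section K w z = K z w"
  by (simp add: kernel_section_def)

lemma kernel_hermitian:
  assumes "z \<in> disc" "w \<in> disc"
  shows "K w z = cnj (K z w)"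
  using reproducing[OF assms(1) section_mem[OF assms(2)]] reproducing[OF assms(2) section_mem[OF assms(1)]]
    ip_cnj[OF section_mem[OF assms(2)] section_mem[OF assms(1)]] assms
  by (simp add: section_apply)

lemma kernel_diag_ge_0: "w \<in> disc \<Longrightarrow> 0 \<le> Re (K w w)"
  using ip_ge_0[OF section_mem] reproducing[OF _ section_mem] by (simp add: section_apply)

lemma kernel_holomorphic:
  assumes "w \<in> disc"
  shows "(\<lambda>z. K z w) holomorphic_on disc"
proof -
  have "kernel_section K w holomorphic_on disc"
    using hilbert section_mem[OF assms] by (simp add: hilbert_analytic_space_def)
  then show ?thesis by (rule holomorphic_transform) (simp add: section_apply)
qed

text \<open>Both sections represent evaluation at \<open>w\<close>, so their difference is
  orthogonal to itself. This identifies \<open>K\<close> pointwise with the kernel that defines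
  \<open>H_k(b)\<close>.\<close>

lemma kernel_unique:
  assumes K': "has_reproducing_kernel H ip K'" and zw: "z \<in> disc" "w \<in> disc"
  shows "K z w = K' z w"
proof -
  have m: "kernel_section K' w \<in> H" and r: "\<And>f. f \<in> H \<Longrightarrow> ip f (kernel_section K' w) = f w"
    using K' zw(2) by (auto simp: has_reproducing_kernel_def)
  let ?d = "\<lambda>z. kernel_section K w z - kernel_section K' w z"
  have d: "?d \<in> H" by (intro diff_mem section_mem zw m)
  have "ip ?d ?d = 0"
    using ip_diff_right[OF section_mem[OF zw(2)] m d] reproducing[OF zw(2) d] r[OF d] by simp
  then have "?d = (\<lambda>z. 0)" by (rule ip_definite[OF d])
  then have "?d z = 0" by (rule fun_cong)
  then show ?thesis using zw(1) by (simp add: kernel_section_def)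
qed

section \<open>Finite kernel combinations and their density\<close>

definition kcomb :: "complex set \<Rightarrow> (complex \<Rightarrow> complex) \<Rightarrow> cfun" where
  "kcomb X a = (\<lambda>z. \<Sum>w\<in>X. a w * kernel_section K w z)"

lemma kcomb_mem: "finite X \<Longrightarrow> X \<subseteq> disc \<Longrightarrow> kcomb X a \<in> H"
  unfolding kcomb_def by (intro lincomb_mem section_mem) auto

lemma ip_kcomb:
  assumes "finite X" "X \<subseteq> disc" "f \<in> H"
  shows "ip f (kcomb X a) = (\<Sum>w\<in>X. cnj (a w) * f w)"
  unfolding kcomb_def using assms
  by (subst ip_lincomb_right) (auto simp: section_mem reproducing subset_eq intro!: sum.cong)

lemma hnorm_kcomb_sq:
  assumes "finite X" "X \<subseteq> disc"
  shows "of_real ((hnorm ip (kcomb X a))\<^sup>2) = (\<Sum>z\<in>X. \<Sum>w\<in>X. cnj (a z) * a w * K z w)"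
  unfolding ip_self[OF kcomb_mem[OF assms], symmetric] ip_kcomb[OF assms kcomb_mem[OF assms]]
  using assms(2) by (auto simp: kcomb_def sum_distrib_left section_apply subset_eq mult.assoc intro!: sum.cong)

text \<open>
  Density of the kernel combinations supported in a set of uniqueness \<open>A\<close>: a minimizing sequence
  for the distance from \<open>g\<close> to their span converges to \<open>g\<close> itself.
\<close>

lemma kcomb_dense:
  assumes A: "A \<subseteq> disc" and uniq: "\<And>f. f \<in> H \<Longrightarrow> (\<And>w. w \<in> A \<Longrightarrow> f w = 0) \<Longrightarrow> f = (\<lambda>z. 0)"
    and g: "g \<in> H"
  obtains x where "\<And>n::nat. x n \<in> {kcomb X a | X a. finite X \<and> X \<subseteq> A}"
    "(\<lambda>n. hnorm ip (\<lambda>z. g z - x n z)) \<longlonglongrightarrow> 0"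
proof -
  define S where "S = {kcomb X a | X a. finite X \<and> X \<subseteq> A}"
  have SH: "s \<in> H" if "s \<in> S" for s using that A kcomb_mem unfolding S_def by auto
  have Scomb: "(\<lambda>z. s z + c * t z) \<in> S" if st: "s \<in> S" "t \<in> S" for s t c
  proof -
    obtain X a Y b where X: "finite X" "X \<subseteq> A" "s = kcomb X a" and Y: "finite Y" "Y \<subseteq> A" "t = kcomb Y b"
      using st unfolding S_def by blast
    have ext: "kcomb X a = kcomb (X \<union> Y) (\<lambda>w. if w \<in> X then a w else 0)"
      "kcomb Y b = kcomb (X \<union> Y) (\<lambda>w. if w \<in> Y then b w else 0)"
      unfolding kcomb_def using X(1) Y(1) by (auto intro!: ext sum.mono_neutral_cong_left)
    have "(\<lambda>z. s z + c * t z) = kcomb (X \<union> Y) (\<lambda>w. (if w \<in> X then a w else 0) + c * (if w \<in> Y then b w else 0))"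
      unfolding X(3) Y(3) ext
      unfolding kcomb_def sum_distrib_left sum.distrib[symmetric] by (simp add: distrib_right mult.assoc)
    moreover have "finite (X \<union> Y)" "X \<union> Y \<subseteq> A" using X Y by auto
    ultimately show ?thesis unfolding S_def by blast
  qed
  have kS: "kernel_section K w \<in> S" if "w \<in> A" for w
  proof -
    have "kernel_section K w = kcomb {w} (\<lambda>_. 1)" by (simp add: kcomb_def)
    then show ?thesis unfolding S_def using that by blast
  qed
  have S0: "(\<lambda>z. 0) \<in> S"
  proof -
    have "(\<lambda>z. 0) = kcomb {} (\<lambda>_. 0)" by (simp add: kcomb_def)
    then show ?thesis unfolding S_def by blast
  qed
  define dset where "dset = (\<lambda>s. (hnorm ip (\<lambda>z. g z - s z))\<^sup>2) ` S"
  define d where "d = Inf dset"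
  have bdd: "bdd_below dset" unfolding dset_def by (rule bdd_belowI2[of _ 0]) auto
  have dle: "d \<le> (hnorm ip (\<lambda>z. g z - s z))\<^sup>2" if "s \<in> S" for s
    unfolding d_def dset_def by (rule cINF_lower[OF bdd[unfolded dset_def] that])
  \<comment> \<open>The gap is a square because the pairings with the span are controlled by its
    square root.\<close>
  have "\<exists>s. s \<in> S \<and> (hnorm ip (\<lambda>z. g z - s z))\<^sup>2 < d + (inverse (Suc n))\<^sup>2" for n :: nat
  proof -
    have "Inf dset < d + (inverse (real (Suc n)))\<^sup>2" by (simp add: d_def)
    then show ?thesis using cInf_lessD[of dset] S0 unfolding dset_def by fastforce
  qed
  then obtain x where x: "\<And>n. x n \<in> S"
    and xd: "\<And>n. (hnorm ip (\<lambda>z. g z - x n z))\<^sup>2 < d + (inverse (Suc n))\<^sup>2" by metis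
  have xH: "x n \<in> H" for n by (rule SH[OF x])
  note gx = diff_mem[OF g xH]
  have ort: "cmod (ip (\<lambda>z. g z - x n z) s) \<le> hnorm ip s * inverse (Suc n)" if s: "s \<in> S" for n s
  proof -
    have "d \<le> (hnorm ip (\<lambda>z. g z - x n z - c * s z))\<^sup>2" for c
      using dle[OF Scomb[OF x s], of n c] by (simp add: diff_diff_eq)
    then have "(cmod (ip (\<lambda>z. g z - x n z) s))\<^sup>2 \<le> (hnorm ip s)\<^sup>2 * ((hnorm ip (\<lambda>z. g z - x n z))\<^sup>2 - d)"
      by (rule ip_bound_of_minimal[OF gx SH[OF s]])
    also have "\<dots> \<le> (hnorm ip s)\<^sup>2 * (inverse (Suc n))\<^sup>2"
      using xd[of n] by (intro mult_left_mono) auto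
    finally show ?thesis
      unfolding power_mult_distrib[symmetric]
      by (rule power2_le_imp_le) (intro mult_nonneg_nonneg hnorm_ge_0 SH[OF s], simp)
  qed
  have cau: "hnorm ip (\<lambda>z. x m z - x n z) \<le> inverse (Suc m) + inverse (Suc n)" for m n
  proof (cases "hnorm ip (\<lambda>z. x m z - x n z) = 0")
    case False
    let ?s = "\<lambda>z. x m z - x n z"
    have sS: "?s \<in> S" using Scomb[OF x x, of m "-1" n] by simp
    note sH = SH[OF sS]
    \<comment> \<open>The vector \<open>?s\<close> lies in the span and is a difference of two
      residuals, each almost orthogonal to the span. Hence its squared norm is at most a small
      multiple of its norm, and one factor cancels.\<close>
    have "ip ?s ?s = ip (\<lambda>z. (g z - x n z) - (g z - x m z)) ?s" by simp
    also have "\<dots> = ip (\<lambda>z. g z - x n z) ?s - ip (\<lambda>z. g z - x m z) ?s"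
      by (rule ip_diff[OF gx gx sH])
    finally have "(hnorm ip ?s)\<^sup>2 = cmod (ip (\<lambda>z. g z - x n z) ?s - ip (\<lambda>z. g z - x m z) ?s)"
      by (metis ip_self[OF sH] norm_of_real abs_power2)
    also have "\<dots> \<le> hnorm ip ?s * inverse (Suc n) + hnorm ip ?s * inverse (Suc m)"
      by (rule order_trans[OF norm_triangle_ineq4]) (intro add_mono ort sS)
    finally have "hnorm ip ?s * hnorm ip ?s \<le> hnorm ip ?s * (inverse (Suc m) + inverse (Suc n))"
      by (simp add: power2_eq_square distrib_left)
    then show ?thesis using False hnorm_ge_0[OF sH] by simp
  qed simp
  have inv0: "(\<lambda>n. inverse (real (Suc n))) \<longlonglongrightarrow> 0" by (rule LIMSEQ_inverse_real_of_nat)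
  have "\<forall>e>0. \<exists>N. \<forall>m\<ge>N. \<forall>n\<ge>N. hnorm ip (\<lambda>z. x m z - x n z) < e"
  proof (intro allI impI)
    fix e :: real assume "e > 0"
    then have "\<forall>\<^sub>F n in sequentially. inverse (real (Suc n)) < e / 2"
      using order_tendstoD(2)[OF inv0, of "e / 2"] by simp
    then obtain N where N: "\<And>n. n \<ge> N \<Longrightarrow> inverse (real (Suc n)) < e / 2"
      unfolding eventually_sequentially by blast
    have "hnorm ip (\<lambda>z. x m z - x n z) < e" if "m \<ge> N" "n \<ge> N" for m n
      using cau[of m n] N[OF that(1)] N[OF that(2)] by linarith
    then show "\<exists>N. \<forall>m\<ge>N. \<forall>n\<ge>N. hnorm ip (\<lambda>z. x m z - x n z) < e" by blast
  qed
  with xH obtain y where y: "y \<in> H" and lim: "(\<lambda>n. hnorm ip (\<lambda>z. x n z - y z)) \<longlonglongrightarrow> 0"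
    using hilbert unfolding hilbert_analytic_space_def by blast
  note xy = diff_mem[OF xH y]
  \<comment> \<open>In the limit the residual is orthogonal to every kernel section at a point of
    \<open>A\<close>, that is, it vanishes on \<open>A\<close>.\<close>
  have "(\<lambda>z. g z - y z) = (\<lambda>z. 0)"
  proof (rule uniq[OF diff_mem[OF g y]])
    fix w assume w: "w \<in> A"
    let ?k = "kernel_section K w"
    have kH: "?k \<in> H" by (rule SH[OF kS[OF w]])
    have wd: "w \<in> disc" using w A by blast
    have "cmod (g w - y w) \<le> hnorm ip ?k * inverse (Suc n) + hnorm ip (\<lambda>z. x n z - y z) * hnorm ip ?k" for n
    proof -
      have "g w - y w = ip (\<lambda>z. g z - x n z) ?k + ip (\<lambda>z. x n z - y z) ?k"
        unfolding reproducing[OF wd gx] reproducing[OF wd xy] by simp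
      then show ?thesis
        using ort[OF kS[OF w], of n] cauchy_schwarz[OF xy kH, of n]
        by (smt (verit) norm_triangle_ineq)
    qed
    moreover have "(\<lambda>n. hnorm ip ?k * inverse (Suc n) + hnorm ip (\<lambda>z. x n z - y z) * hnorm ip ?k)
        \<longlonglongrightarrow> hnorm ip ?k * 0 + 0 * hnorm ip ?k"
      by (intro tendsto_intros inv0 lim)
    ultimately have "cmod (g w - y w) \<le> hnorm ip ?k * 0 + 0 * hnorm ip ?k"
      by (intro LIMSEQ_le_const) auto
    then show "g w - y w = 0" by simp
  qed
  then have gy: "g = y" by (simp add: fun_eq_iff)
  \<comment> \<open>Symmetry of the distance, read off from \<open>hnorm_sq_diff\<close> with the
    zero function as first argument and \<open>c = 1\<close>.\<close>
  have "hnorm ip (\<lambda>z. g z - x n z) = hnorm ip (\<lambda>z. x n z - y z)" for n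
    using hnorm_sq_diff[OF zero_mem xy, of 1 n] hnorm_ge_0[OF xy, of n] hnorm_ge_0[OF gx, of n]
    by (simp add: gy ip_zero[OF xy] hnorm_def ip_zero[OF zero_mem])
  then have "(\<lambda>n. hnorm ip (\<lambda>z. g z - x n z)) \<longlonglongrightarrow> 0" using lim by simp
  then show ?thesis using that[of x] x unfolding S_def by blast
qed

text \<open>Testing against kernel combinations that converge to \<open>g\<close> itself turns the
  assumed bound, in the limit, into
  \<open>(hnorm ip g)\<^sup>2 \<le> C * hnorm ip g\<close>.\<close>

lemma hnorm_le_of_kcomb:
  assumes A: "A \<subseteq> disc" and uniq: "\<And>f. f \<in> H \<Longrightarrow> (\<And>w. w \<in> A \<Longrightarrow> f w = 0) \<Longrightarrow> f = (\<lambda>z. 0)"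
    and g: "g \<in> H"
    and le: "\<And>X a. finite X \<Longrightarrow> X \<subseteq> A \<Longrightarrow> cmod (ip g (kcomb X a)) \<le> C * hnorm ip (kcomb X a)"
    and C: "0 \<le> C"
  shows "hnorm ip g \<le> C"
proof -
  obtain x where x: "\<And>n::nat. x n \<in> {kcomb X a | X a. finite X \<and> X \<subseteq> A}"
    and lim: "(\<lambda>n. hnorm ip (\<lambda>z. g z - x n z)) \<longlonglongrightarrow> 0"
    using kcomb_dense[OF A uniq g] by blast
  let ?e = "\<lambda>n. hnorm ip (\<lambda>z. g z - x n z)"
  have xH: "x n \<in> H" for n using x[of n] A kcomb_mem by auto
  have xC: "cmod (ip g (x n)) \<le> C * hnorm ip (x n)" for n using x[of n] le by auto
  have "(hnorm ip g)\<^sup>2 \<le> hnorm ip g * ?e n + C * (hnorm ip g + ?e n)" for n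
  proof -
    note gx = diff_mem[OF g xH]
    have "hnorm ip (x n) \<le> hnorm ip g + ?e n"
    proof -
      have "(\<lambda>z. g z - (g z - x n z)) = x n" by simp
      moreover have "(hnorm ip (\<lambda>z. g z - 1 * (g z - x n z)))\<^sup>2 \<le> (hnorm ip g + ?e n)\<^sup>2"
        unfolding hnorm_sq_diff[OF g gx]
        using cauchy_schwarz[OF g gx, of n] abs_Re_le_cmod[of "ip g (\<lambda>z. g z - x n z)"]
        by (simp add: power2_sum)
      ultimately show ?thesis
        using power2_le_imp_le[of "hnorm ip (x n)" "hnorm ip g + ?e n"] hnorm_ge_0[OF g] hnorm_ge_0[OF gx] by simp
    qed
    then have "cmod (ip g (x n)) \<le> C * (hnorm ip g + ?e n)"
      using xC[of n] mult_left_mono[OF _ C] order_trans by blast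
    moreover have "ip g g = ip g (\<lambda>z. g z - x n z) + ip g (x n)" using ip_diff_right[OF g xH g] by simp
    then have "cmod (ip g g) \<le> cmod (ip g (\<lambda>z. g z - x n z)) + cmod (ip g (x n))"
      by (metis norm_triangle_ineq)
    moreover have "cmod (ip g g) = (hnorm ip g)\<^sup>2" by (simp only: ip_self[OF g] norm_of_real abs_power2)
    ultimately show ?thesis using cauchy_schwarz[OF g gx, of n] by linarith
  qed
  moreover have "(\<lambda>n. hnorm ip g * ?e n + C * (hnorm ip g + ?e n)) \<longlonglongrightarrow> hnorm ip g * 0 + C * (hnorm ip g + 0)"
    by (intro tendsto_intros lim)
  ultimately have "(hnorm ip g)\<^sup>2 \<le> hnorm ip g * 0 + C * (hnorm ip g + 0)"
    by (intro LIMSEQ_le_const) auto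
  then have "hnorm ip g * hnorm ip g \<le> C * hnorm ip g" by (simp add: power2_eq_square)
  then show ?thesis using C hnorm_ge_0[OF g] by (cases "hnorm ip g = 0") auto
qed

end

subsection \<open>The contraction inequality and the kernel \<open>1 - K / k\<close>\<close>

locale bergman_rkhs = rkhs +
  fixes \<phi> :: "complex \<Rightarrow> complex" and u :: "complex \<Rightarrow> nat \<Rightarrow> complex"
    and k :: "complex \<Rightarrow> complex \<Rightarrow> complex"
  assumes bergman: "bergman_type_kernel \<phi> u k"
    and normalized: "normalized_at_0 K"
    and mult: "\<phi> \<in> Mult H"
    and codim: "codim_1_in_H H (mult_range H \<phi>)"
    and row: "u \<in> Mult_row H ip"
begin

lemma phi_0: "\<phi> 0 = 0" and phi_holomorphic: "\<phi> holomorphic_on disc" and u_analytic: "l2_analytic u"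
  and psd_k: "psd_kernel k"
  using bergman unfolding bergman_type_kernel_def by blast+

lemma k_inverse:
  assumes "z \<in> disc" "w \<in> disc"
  shows "k z w * (1 - \<phi> z * cnj (\<phi> w) * (1 - l2_inner (u z) (u w))) = 1"
proof -
  let ?d = "1 - \<phi> z * cnj (\<phi> w) * (1 - l2_inner (u z) (u w))"
  have "?d \<noteq> 0 \<and> k z w = 1 / ?d"
    using bergman assms unfolding bergman_type_kernel_def by blast
  then show ?thesis by simp
qed

lemma phi_nz:
  assumes "z \<in> disc - {0}"
  shows "\<phi> z \<noteq> 0"
proof -
  obtain g m where "\<forall>z\<in>disc. \<phi> z = z * g z" "0 < m" "\<forall>z\<in>disc. m \<le> cmod (g z)"
    using bergman unfolding bergman_type_kernel_def by blast
  then show ?thesis using assms by fastforce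
qed

lemma u_l2: "z \<in> disc \<Longrightarrow> u z \<in> l2"
  using u_analytic by (rule l2_analyticD)

lemma K_0:
  assumes "z \<in> disc"
  shows "K z 0 = 1" "K 0 z = 1"
proof -
  show "K z 0 = 1" using normalized assms by (simp add: normalized_at_0_def)
  then show "K 0 z = 1" using kernel_hermitian[of z 0] assms by simp
qed

lemma phi_mult_mem: "f \<in> H \<Longrightarrow> (\<lambda>z. \<phi> z * f z) \<in> H"
  using mult by (simp add: Mult_def)

text \<open>Every function in the range vanishes at \<open>0\<close>, while the section at
  \<open>0\<close> lies in \<open>H\<close> and has the value \<open>1\<close> there. So the vector
  \<open>e\<close> spanning the quotient cannot vanish at \<open>0\<close>, and a function that does
  vanish has no component along \<open>e\<close>.\<close>

lemma phi_quotient: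
  assumes f: "f \<in> H" "f 0 = 0"
  obtains h where "h \<in> H" "f = (\<lambda>z. \<phi> z * h z)"
proof -
  let ?R = "mult_range H \<phi>" and ?one = "kernel_section K 0"
  have R0: "r 0 = 0" if "r \<in> ?R" for r using that phi_0 by (auto simp: mult_range_def)
  obtain e where e: "e \<in> H" and span: "\<And>f. f \<in> H \<Longrightarrow> \<exists>c. (\<lambda>z. f z - c * e z) \<in> ?R"
    using codim unfolding codim_1_in_H_def by blast
  have "?one \<in> H" by (rule section_mem) simp
  then obtain c' where "(\<lambda>z. ?one z - c' * e z) \<in> ?R" using span by blast
  from R0[OF this] have e0: "e 0 \<noteq> 0" by (auto simp: kernel_section_def K_0)
  obtain c where c: "(\<lambda>z. f z - c * e z) \<in> ?R" using span[OF f(1)] by blast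
  from R0[OF this] have "c = 0" using f(2) e0 by simp
  then show ?thesis using c that by (auto simp: mult_range_def)
qed

text \<open>The factor \<open>1 / k\<close> is written out as the denominator of \<open>k\<close>;
  this shows holomorphy in \<open>z\<close> directly and involves no division.\<close>

definition E :: "complex \<Rightarrow> complex \<Rightarrow> complex" where
  "E z w = 1 - K z w * (1 - \<phi> z * cnj (\<phi> w) * (1 - l2_inner (u z) (u w)))"

lemma K_eq_k_E:
  assumes "z \<in> disc" "w \<in> disc"
  shows "K z w = k z w * (1 - E z w)"
proof -
  let ?d = "1 - \<phi> z * cnj (\<phi> w) * (1 - l2_inner (u z) (u w))"
  have "k z w * (1 - E z w) = k z w * ?d * K z w" by (simp add: E_def)
  then show ?thesis unfolding k_inverse[OF assms] by simp
qed

lemma E_0: "z \<in> disc \<Longrightarrow> E z 0 = 0" "z \<in> disc \<Longrightarrow> E 0 z = 0"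
  by (simp_all add: E_def K_0 phi_0)

lemma E_eqI:
  assumes "z \<in> disc" "w \<in> disc" and "K z w = k z w * (1 - x)"
  shows "E z w = x"
proof -
  let ?d = "1 - \<phi> z * cnj (\<phi> w) * (1 - l2_inner (u z) (u w))"
  have "E z w = 1 - k z w * ?d * (1 - x)" unfolding E_def assms(3) by (simp only: mult_ac)
  then show ?thesis unfolding k_inverse[OF assms(1,2)] by simp
qed

text \<open>Evaluation at \<open>w\<close> is bounded, so the products of
  \<open>cmod (u w n)\<close> and \<open>hnorm ip (F n)\<close> give a summable majorant. Without
  convergence the value of \<open>row_mult\<close> could not be used.\<close>

lemma row_mult_sums:
  assumes F: "F \<in> H_l2 H ip" and w: "w \<in> disc"
  shows "(\<lambda>n. u w n * F n w) sums row_mult u F w"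
proof -
  let ?k = "kernel_section K w"
  have FH: "F n \<in> H" for n using F by (simp add: H_l2_def)
  have "summable (\<lambda>n. \<bar>cmod (u w n)\<bar> * \<bar>hnorm ip (F n)\<bar>)"
    using suminf_cauchy_schwarz(1)[of "\<lambda>n. cmod (u w n)" "\<lambda>n. hnorm ip (F n)"] u_l2[OF w] F
    by (simp add: l2_def H_l2_def)
  then have "summable (\<lambda>n. \<bar>cmod (u w n)\<bar> * \<bar>hnorm ip (F n)\<bar> * hnorm ip ?k)" by (rule summable_mult2)
  moreover have "norm (u w n * F n w) \<le> \<bar>cmod (u w n)\<bar> * \<bar>hnorm ip (F n)\<bar> * hnorm ip ?k" for n
  proof -
    have "cmod (F n w) \<le> hnorm ip (F n) * hnorm ip ?k"
      using cauchy_schwarz[OF FH section_mem[OF w], of n] reproducing[OF w FH, of n] by simp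
    then show ?thesis using hnorm_ge_0[OF FH, of n] by (simp add: norm_mult mult.assoc mult_left_mono)
  qed
  ultimately have "summable (\<lambda>n. u w n * F n w)"
    by (rule summable_comparison_test'[where N = 0])
  then show ?thesis unfolding row_mult_def by (rule summable_sums)
qed

text \<open>The difference of sections is the reproducing kernel at \<open>w\<close> of the
  functions vanishing at \<open>0\<close>, and the factor \<open>1 / cnj (\<phi> w)\<close> makes
  pairing with \<open>\<phi> f0\<close> evaluate \<open>f0\<close>.\<close>

definition phi_part :: "complex set \<Rightarrow> (complex \<Rightarrow> complex) \<Rightarrow> cfun" where
  "phi_part X a = (\<lambda>z. \<Sum>w\<in>X. a w / cnj (\<phi> w) * (kernel_section K w z - kernel_section K 0 z))"

definition row_part :: "complex set \<Rightarrow> (complex \<Rightarrow> complex) \<Rightarrow> nat \<Rightarrow> cfun" where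
  "row_part X a n = kcomb X (\<lambda>w. a w * cnj (u w n))"

context
  fixes X :: "complex set" and a :: "complex \<Rightarrow> complex"
  assumes X: "finite X" "X \<subseteq> disc - {0}"
begin

lemma X_disc: "X \<subseteq> disc" and X_mem: "w \<in> X \<Longrightarrow> w \<in> disc" and X_phi_nz: "w \<in> X \<Longrightarrow> \<phi> w \<noteq> 0"
  using X phi_nz by blast+

lemma section_diff_mem: "w \<in> X \<Longrightarrow> (\<lambda>z. kernel_section K w z - kernel_section K 0 z) \<in> H"
  by (intro diff_mem section_mem) (use X_mem in auto)

lemma phi_part_mem: "phi_part X a \<in> H"
  unfolding phi_part_def by (intro lincomb_mem X section_diff_mem)

lemma phi_part_apply:
  assumes "z \<in> disc"
  shows "phi_part X a z = (\<Sum>w\<in>X. a w / cnj (\<phi> w) * (K z w - 1))"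
  using assms by (simp add: phi_part_def section_apply K_0)

lemma phi_part_0: "phi_part X a 0 = 0"
proof -
  have "(\<Sum>w\<in>X. a w / cnj (\<phi> w) * (K 0 w - 1)) = 0"
    by (intro sum.neutral ballI) (simp only: K_0(2)[OF X_mem], simp)
  then show ?thesis using phi_part_apply[of 0] by simp
qed

lemma ip_phi_part:
  assumes h: "h \<in> H" "h 0 = 0"
  shows "ip h (phi_part X a) = (\<Sum>z\<in>X. cnj (a z) / \<phi> z * h z)"
proof -
  have 0: "0 \<in> disc" by simp
  have "ip h (phi_part X a)
      = (\<Sum>z\<in>X. cnj (a z / cnj (\<phi> z)) * ip h (\<lambda>w. kernel_section K z w - kernel_section K 0 w))"
    unfolding phi_part_def by (intro ip_lincomb_right X section_diff_mem h)
  also have "\<dots> = (\<Sum>z\<in>X. cnj (a z) / \<phi> z * h z)"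
  proof (intro sum.cong refl)
    fix z assume "z \<in> X"
    then have z: "z \<in> disc" by (rule X_mem)
    have "ip h (\<lambda>w. kernel_section K z w - kernel_section K 0 w) = h z - h 0"
      unfolding ip_diff_right[OF section_mem[OF z] section_mem[OF 0] h(1)] reproducing[OF z h(1)]
        reproducing[OF 0 h(1)] ..
    then show "cnj (a z / cnj (\<phi> z)) * ip h (\<lambda>w. kernel_section K z w - kernel_section K 0 w)
        = cnj (a z) / \<phi> z * h z" using h(2) by simp
  qed
  finally show ?thesis .
qed

lemma hnorm_phi_part_sq:
  "of_real ((hnorm ip (phi_part X a))\<^sup>2)
    = (\<Sum>z\<in>X. \<Sum>w\<in>X. cnj (a z) * a w * ((K z w - 1) / (\<phi> z * cnj (\<phi> w))))"
proof -
  have "of_real ((hnorm ip (phi_part X a))\<^sup>2) = (\<Sum>z\<in>X. cnj (a z) / \<phi> z * phi_part X a z)"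
    unfolding ip_self[OF phi_part_mem, symmetric] by (rule ip_phi_part[OF phi_part_mem phi_part_0])
  also have "\<dots> = (\<Sum>z\<in>X. cnj (a z) / \<phi> z * (\<Sum>w\<in>X. a w / cnj (\<phi> w) * (K z w - 1)))"
    by (intro sum.cong refl) (simp only: phi_part_apply[OF X_mem])
  also have "\<dots> = (\<Sum>z\<in>X. \<Sum>w\<in>X. cnj (a z) * a w * ((K z w - 1) / (\<phi> z * cnj (\<phi> w))))"
    unfolding sum_distrib_left by (intro sum.cong refl) simp
  finally show ?thesis .
qed

lemma row_part_mem: "row_part X a n \<in> H"
  unfolding row_part_def by (rule kcomb_mem[OF X(1) X_disc])

lemma hnorm_row_part_sq_sums:
  "(\<lambda>n. of_real ((hnorm ip (row_part X a n))\<^sup>2))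
    sums (\<Sum>z\<in>X. \<Sum>w\<in>X. cnj (a z) * a w * (l2_inner (u z) (u w) * K z w))"
proof -
  have "(\<lambda>n. \<Sum>z\<in>X. \<Sum>w\<in>X. cnj (a z) * a w * (u z n * cnj (u w n) * K z w))
      sums (\<Sum>z\<in>X. \<Sum>w\<in>X. cnj (a z) * a w * (l2_inner (u z) (u w) * K z w))"
    by (intro sums_sum sums_mult sums_mult2 l2_inner_sums u_l2 X_mem)
  moreover have "of_real ((hnorm ip (row_part X a n))\<^sup>2)
      = (\<Sum>z\<in>X. \<Sum>w\<in>X. cnj (a z) * a w * (u z n * cnj (u w n) * K z w))" for n
    unfolding row_part_def hnorm_kcomb_sq[OF X(1) X_disc]
    by (intro sum.cong refl) (simp add: mult_ac)
  ultimately show ?thesis by simp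
qed

lemma row_part_H_l2: "row_part X a \<in> H_l2 H ip"
proof -
  have "summable (\<lambda>n. (hnorm ip (row_part X a n))\<^sup>2)"
    using sums_summable[OF sums_Re[OF hnorm_row_part_sq_sums]] by (simp only: Re_complex_of_real)
  then show ?thesis by (simp add: H_l2_def row_part_mem)
qed

text \<open>The factor \<open>1 / (\<phi> z * cnj (\<phi> w))\<close> is absorbed into the
  coefficients. As \<open>\<phi>\<close> has no zero on \<open>X\<close>, the vectors
  \<open>cnj (a z) / \<phi> z\<close> exhaust all coefficients, so a nonnegative defect for every
  \<open>a\<close> amounts to positivity of \<open>E\<close> on \<open>X\<close>.\<close>

lemma parts_defect:
  "of_real ((hnorm ip (kcomb X a))\<^sup>2 - (hnorm ip (phi_part X a))\<^sup>2 - (\<Sum>n. (hnorm ip (row_part X a n))\<^sup>2))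
    = (\<Sum>z\<in>X. \<Sum>w\<in>X. cnj (a z) / \<phi> z * cnj (cnj (a w) / \<phi> w) * E z w)"
proof -
  let ?S = "\<Sum>z\<in>X. \<Sum>w\<in>X. cnj (a z) * a w * (l2_inner (u z) (u w) * K z w)"
  have "(\<lambda>n. complex_of_real ((hnorm ip (row_part X a n))\<^sup>2)) sums of_real (\<Sum>n. (hnorm ip (row_part X a n))\<^sup>2)"
    unfolding sums_of_real_iff by (rule summable_sums) (use row_part_H_l2 in \<open>simp add: H_l2_def\<close>)
  then have "of_real (\<Sum>n. (hnorm ip (row_part X a n))\<^sup>2) = ?S"
    using hnorm_row_part_sq_sums by (rule sums_unique2)
  then have "of_real ((hnorm ip (kcomb X a))\<^sup>2 - (hnorm ip (phi_part X a))\<^sup>2 - (\<Sum>n. (hnorm ip (row_part X a n))\<^sup>2))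
      = (\<Sum>z\<in>X. \<Sum>w\<in>X. cnj (a z) * a w * K z w)
        - (\<Sum>z\<in>X. \<Sum>w\<in>X. cnj (a z) * a w * ((K z w - 1) / (\<phi> z * cnj (\<phi> w)))) - ?S"
    by (simp only: of_real_diff hnorm_kcomb_sq[OF X(1) X_disc] hnorm_phi_part_sq)
  also have "\<dots> = (\<Sum>z\<in>X. \<Sum>w\<in>X. cnj (a z) / \<phi> z * cnj (cnj (a w) / \<phi> w) * E z w)"
    unfolding sum_subtractf[symmetric]
    by (intro sum.cong refl) (use X_phi_nz in \<open>simp add: E_def field_simps\<close>)
  finally show ?thesis .
qed

text \<open>The parts are the components of the adjoint of \<open>(f0, F) \<mapsto> f0 + row_mult u F\<close> at \<open>kcomb X a\<close>.\<close>

lemma adjoint_sums: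
  assumes f0: "f0 \<in> H" and F: "F \<in> H_l2 H ip" and g: "(\<lambda>z. f0 z + row_mult u F z) \<in> H"
  shows "(\<lambda>n. ip (F n) (row_part X a n))
    sums (ip (\<lambda>z. f0 z + row_mult u F z) (kcomb X a) - ip (\<lambda>z. \<phi> z * f0 z) (phi_part X a))"
proof -
  have FH: "F n \<in> H" for n using F by (simp add: H_l2_def)
  have "(\<lambda>n. \<Sum>w\<in>X. cnj (a w) * (u w n * F n w)) sums (\<Sum>w\<in>X. cnj (a w) * row_mult u F w)"
    by (intro sums_sum sums_mult row_mult_sums F X_mem)
  moreover have "ip (F n) (row_part X a n) = (\<Sum>w\<in>X. cnj (a w) * (u w n * F n w))" for n
    unfolding row_part_def ip_kcomb[OF X(1) X_disc FH] by (simp add: mult.assoc)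
  moreover have "ip (\<lambda>z. \<phi> z * f0 z) (phi_part X a) = (\<Sum>w\<in>X. cnj (a w) * f0 w)"
    using ip_phi_part[OF phi_mult_mem[OF f0]] X_phi_nz by (simp add: phi_0)
  moreover have "ip (\<lambda>z. f0 z + row_mult u F z) (kcomb X a)
      = (\<Sum>w\<in>X. cnj (a w) * f0 w) + (\<Sum>w\<in>X. cnj (a w) * row_mult u F w)"
    unfolding ip_kcomb[OF X(1) X_disc g] by (simp add: distrib_left sum.distrib)
  ultimately show ?thesis by simp
qed

end

section \<open>The two directions between the inequality and positivity of the defect\<close>

lemma sum_mem:
  assumes "f0 \<in> H" "F \<in> H_l2 H ip"
  shows "(\<lambda>z. f0 z + row_mult u F z) \<in> H"
  using assms row by (intro add_mem) (simp_all add: Mult_row_def)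

text \<open>By continuity the punctured disc is still a set of uniqueness for \<open>H\<close>, as
  the density of kernel combinations with nodes there requires.\<close>

lemma vanishing_off_0:
  assumes f: "f \<in> H" and v: "\<And>w. w \<in> disc - {0} \<Longrightarrow> f w = 0"
  shows "f = (\<lambda>z. 0)"
proof -
  have "f holomorphic_on disc" using hilbert f by (simp add: hilbert_analytic_space_def)
  then have "continuous_on disc f" by (rule holomorphic_on_imp_continuous_on)
  then have "isCont f 0" by (simp add: continuous_on_eq_continuous_at)
  then have l: "(f \<longlongrightarrow> f 0) (at 0)" by (simp add: isCont_def)
  have "\<forall>\<^sub>F w in at 0. w \<in> disc - {0}" by (intro eventually_at_in_open) auto
  then have "\<forall>\<^sub>F w in at 0. f w = 0" by (rule eventually_mono) (rule v)
  then have "((\<lambda>w::complex. 0) \<longlongrightarrow> f 0) (at 0)" by (rule Lim_transform_eventually[OF l])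
  then have "f 0 = 0" by (simp add: tendsto_const_iff)
  then show ?thesis using v zero_outside[OF f] by (metis DiffI singletonD ext)
qed

text \<open>Since \<open>E\<close> is a Gram kernel of \<open>b\<close>, the defect is nonnegative,
  so the adjoint does not increase the norm of a kernel combination. Moving the row map across the
  pairing bounds the pairings of the image with kernel combinations, and density carries the bound
  to its norm.\<close>

lemma inequality_if_H_kb:
  assumes b: "\<And>z. z \<in> disc \<Longrightarrow> b z \<in> l2" and H_kb: "is_H_kb H ip k b"
    and f0: "f0 \<in> H" and F: "F \<in> H_l2 H ip"
  shows "(hnorm ip (\<lambda>z. f0 z + row_mult u F z))\<^sup>2
    \<le> (hnorm ip (\<lambda>z. \<phi> z * f0 z))\<^sup>2 + (\<Sum>n. (hnorm ip (F n))\<^sup>2)"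
proof -
  let ?g = "\<lambda>z. f0 z + row_mult u F z" and ?p = "\<lambda>z. \<phi> z * f0 z"
  have FH: "F n \<in> H" for n using F by (simp add: H_l2_def)
  have Fs: "summable (\<lambda>n. (hnorm ip (F n))\<^sup>2)" using F by (simp add: H_l2_def)
  define C where "C = (hnorm ip ?p)\<^sup>2 + (\<Sum>n. (hnorm ip (F n))\<^sup>2)"
  have sF: "0 \<le> (\<Sum>n. (hnorm ip (F n))\<^sup>2)" by (rule suminf_nonneg[OF Fs]) simp
  then have C0: "0 \<le> C" by (simp add: C_def)
  note g = sum_mem[OF f0 F]
  have Eb: "E z w = l2_inner (b z) (b w)" if "z \<in> disc" "w \<in> disc" for z w
    using kernel_unique[OF H_kb[unfolded is_H_kb_def] that] by (rule E_eqI[OF that])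
  have bound: "cmod (ip ?g (kcomb X a)) \<le> sqrt C * hnorm ip (kcomb X a)"
    if X: "finite X" "X \<subseteq> disc - {0}" for X a
  proof -
    let ?P = "phi_part X a" and ?G = "row_part X a"
    define Q where "Q = (hnorm ip ?P)\<^sup>2 + (\<Sum>n. (hnorm ip (?G n))\<^sup>2)"
    have XD: "X \<subseteq> disc" using X by blast
    have kH: "kcomb X a \<in> H" by (rule kcomb_mem[OF X(1) XD])
    have Gs: "summable (\<lambda>n. (hnorm ip (?G n))\<^sup>2)" using row_part_H_l2[OF X, of a] by (simp add: H_l2_def)
    have sG: "0 \<le> (\<Sum>n. (hnorm ip (?G n))\<^sup>2)" by (rule suminf_nonneg[OF Gs]) simp
    have "of_real ((hnorm ip (kcomb X a))\<^sup>2 - (hnorm ip ?P)\<^sup>2 - (\<Sum>n. (hnorm ip (?G n))\<^sup>2))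
        = (\<Sum>z\<in>X. \<Sum>w\<in>X. cnj (a z) / \<phi> z * cnj (cnj (a w) / \<phi> w) * l2_inner (b z) (b w))"
      unfolding parts_defect[OF X] using Eb XD by (intro sum.cong refl) (simp add: subset_eq)
    then have "(hnorm ip (kcomb X a))\<^sup>2 - (hnorm ip ?P)\<^sup>2 - (\<Sum>n. (hnorm ip (?G n))\<^sup>2)
        = Re (\<Sum>z\<in>X. \<Sum>w\<in>X. cnj (a z) / \<phi> z * cnj (cnj (a w) / \<phi> w) * l2_inner (b z) (b w))"
      by (metis Re_complex_of_real)
    also have "\<dots> \<ge> 0" by (rule psd_kernel_l2_inner[OF X(1)]) (use b XD in blast)
    finally have "Q \<le> (hnorm ip (kcomb X a))\<^sup>2" by (simp add: Q_def)
    then have Qle: "sqrt Q \<le> hnorm ip (kcomb X a)" using hnorm_ge_0[OF kH] by (intro real_le_lsqrt) auto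
    note CS = suminf_cauchy_schwarz[OF Fs Gs]
    have le: "cmod (ip (F n) (?G n)) \<le> \<bar>hnorm ip (F n)\<bar> * \<bar>hnorm ip (?G n)\<bar>" for n
      using cauchy_schwarz[OF FH row_part_mem[OF X], of n] hnorm_ge_0[OF FH, of n]
        hnorm_ge_0[OF row_part_mem[OF X], of a n] by simp
    have sn: "summable (\<lambda>n. cmod (ip (F n) (?G n)))"
      by (rule summable_comparison_test'[OF CS(1), where N = 0]) (use le in simp)
    have split: "ip ?g (kcomb X a) = ip ?p ?P + (\<Sum>n. ip (F n) (?G n))"
      using adjoint_sums[OF X f0 F g, of a] by (simp add: sums_iff)
    have "cmod (ip ?g (kcomb X a)) \<le> hnorm ip ?p * hnorm ip ?P
        + sqrt (\<Sum>n. (hnorm ip (F n))\<^sup>2) * sqrt (\<Sum>n. (hnorm ip (?G n))\<^sup>2)"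
      unfolding split
    proof (rule norm_triangle_le, rule add_mono)
      show "cmod (ip ?p ?P) \<le> hnorm ip ?p * hnorm ip ?P"
        by (rule cauchy_schwarz[OF phi_mult_mem[OF f0] phi_part_mem[OF X]])
      have "cmod (\<Sum>n. ip (F n) (?G n)) \<le> (\<Sum>n. cmod (ip (F n) (?G n)))" by (rule summable_norm[OF sn])
      also have "\<dots> \<le> (\<Sum>n. \<bar>hnorm ip (F n)\<bar> * \<bar>hnorm ip (?G n)\<bar>)" by (rule suminf_le[OF le sn CS(1)])
      finally show "cmod (\<Sum>n. ip (F n) (?G n))
          \<le> sqrt (\<Sum>n. (hnorm ip (F n))\<^sup>2) * sqrt (\<Sum>n. (hnorm ip (?G n))\<^sup>2)"
        using CS(2) by linarith
    qed
    also have "\<dots> \<le> sqrt C * sqrt Q"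
    proof -
      \<comment> \<open>Cauchy--Schwarz in the plane recombines the two components into
        \<open>C\<close> and \<open>Q\<close>.\<close>
      have two: "x * y + p * q \<le> sqrt (x\<^sup>2 + p\<^sup>2) * sqrt (y\<^sup>2 + q\<^sup>2)" for x y p q :: real
      proof -
        have "(x\<^sup>2 + p\<^sup>2) * (y\<^sup>2 + q\<^sup>2) - (x * y + p * q)\<^sup>2 = (x * q - p * y)\<^sup>2"
          by (simp add: power2_eq_square algebra_simps)
        then have "(x * y + p * q)\<^sup>2 \<le> (x\<^sup>2 + p\<^sup>2) * (y\<^sup>2 + q\<^sup>2)"
          using zero_le_power2[of "x * q - p * y"] by linarith
        then show ?thesis unfolding real_sqrt_mult[symmetric] by (rule real_le_rsqrt)
      qed
      show ?thesis
        using two[of "hnorm ip ?p" "hnorm ip ?P" "sqrt (\<Sum>n. (hnorm ip (F n))\<^sup>2)" "sqrt (\<Sum>n. (hnorm ip (?G n))\<^sup>2)"] sF sG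
        by (simp add: C_def Q_def)
    qed
    also have "\<dots> \<le> sqrt C * hnorm ip (kcomb X a)" using Qle C0 by (intro mult_left_mono) auto
    finally show ?thesis .
  qed
  have "hnorm ip ?g \<le> sqrt C"
    by (rule hnorm_le_of_kcomb[OF Diff_subset vanishing_off_0 g bound]) (use C0 in simp_all)
  then have "(hnorm ip ?g)\<^sup>2 \<le> (sqrt C)\<^sup>2" by (rule power_mono) (rule hnorm_ge_0[OF g])
  then show ?thesis using C0 by (simp add: C_def)
qed

text \<open>The inequality is tested on the value of the adjoint at \<open>kcomb X a\<close>. Its
  squared norm \<open>Q\<close> is then the pairing of the image with \<open>kcomb X a\<close>, so
  Cauchy--Schwarz and the inequality give
  \<open>Q\<^sup>2 \<le> Q * (hnorm ip (kcomb X a))\<^sup>2\<close>, and cancelling \<open>Q\<close>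
  leaves a nonnegative defect.\<close>

lemma psd_E_if_inequality:
  assumes ineq: "\<And>f0 F. f0 \<in> H \<Longrightarrow> F \<in> H_l2 H ip \<Longrightarrow>
    (hnorm ip (\<lambda>z. f0 z + row_mult u F z))\<^sup>2
      \<le> (hnorm ip (\<lambda>z. \<phi> z * f0 z))\<^sup>2 + (\<Sum>n. (hnorm ip (F n))\<^sup>2)"
  shows "psd_kernel E"
  unfolding psd_kernel_def
proof (intro allI impI)
  fix Y :: "complex set" and c :: "complex \<Rightarrow> complex"
  assume Y: "finite Y \<and> Y \<subseteq> disc"
  define X where "X = Y - {0}"
  have X: "finite X" "X \<subseteq> disc - {0}" using Y by (auto simp: X_def)
  then have XD: "X \<subseteq> disc" by blast
  \<comment> \<open>This choice makes \<open>cnj (a z) / \<phi> z\<close> equal to the prescribed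
    coefficient \<open>c z\<close>.\<close>
  define a where "a w = cnj (c w * \<phi> w)" for w
  let ?P = "phi_part X a" and ?G = "row_part X a"
  define Q where "Q = (hnorm ip ?P)\<^sup>2 + (\<Sum>n. (hnorm ip (?G n))\<^sup>2)"
  note P = phi_part_mem[OF X, of a] and G = row_part_H_l2[OF X, of a]
  have kH: "kcomb X a \<in> H" by (rule kcomb_mem[OF X(1) XD])
  have Gs: "summable (\<lambda>n. (hnorm ip (?G n))\<^sup>2)" using G by (simp add: H_l2_def)
  have Q0: "0 \<le> Q" unfolding Q_def by (intro add_nonneg_nonneg suminf_nonneg Gs) auto
  \<comment> \<open>The inequality takes \<open>f0\<close> as input, so the first component of the
    adjoint must be divisible by \<open>\<phi>\<close> within \<open>H\<close>; here the codimension
    enters.\<close>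
  obtain f0 where f0: "f0 \<in> H" and Pf: "?P = (\<lambda>z. \<phi> z * f0 z)"
    using phi_quotient[OF P phi_part_0[OF X]] .
  let ?g = "\<lambda>z. f0 z + row_mult u ?G z"
  note g = sum_mem[OF f0 G]
  have "(hnorm ip ?g)\<^sup>2 \<le> Q" using ineq[OF f0 G] by (simp add: Q_def Pf)
  have "(\<lambda>n. ip (?G n) (?G n)) sums of_real (\<Sum>n. (hnorm ip (?G n))\<^sup>2)"
    unfolding ip_self[OF row_part_mem[OF X]] sums_of_real_iff by (rule summable_sums[OF Gs])
  with adjoint_sums[OF X f0 G g, of a]
  have "ip ?g (kcomb X a) - ip ?P ?P = of_real (\<Sum>n. (hnorm ip (?G n))\<^sup>2)"
    unfolding Pf by (rule sums_unique2)
  then have "ip ?g (kcomb X a) = of_real Q"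
    unfolding ip_self[OF P] Q_def of_real_add by (simp add: algebra_simps)
  then have "Q \<le> hnorm ip ?g * hnorm ip (kcomb X a)"
    using cauchy_schwarz[OF g kH] Q0 by simp
  then have "Q\<^sup>2 \<le> (hnorm ip ?g)\<^sup>2 * (hnorm ip (kcomb X a))\<^sup>2"
    unfolding power_mult_distrib[symmetric] using Q0 by (rule power_mono)
  also have "\<dots> \<le> Q * (hnorm ip (kcomb X a))\<^sup>2"
    using \<open>(hnorm ip ?g)\<^sup>2 \<le> Q\<close> by (rule mult_right_mono) simp
  finally have "Q \<le> (hnorm ip (kcomb X a))\<^sup>2"
    using Q0 by (cases "Q = 0") (auto simp: power2_eq_square)
  then have nonneg: "0 \<le> (hnorm ip (kcomb X a))\<^sup>2 - (hnorm ip ?P)\<^sup>2 - (\<Sum>n. (hnorm ip (?G n))\<^sup>2)"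
    by (simp add: Q_def)
  have "(\<Sum>z\<in>Y. \<Sum>w\<in>Y. c z * cnj (c w) * E z w) = (\<Sum>z\<in>X. \<Sum>w\<in>Y. c z * cnj (c w) * E z w)"
    using Y E_0(2) by (intro sum.mono_neutral_right) (auto simp: X_def subset_eq intro!: sum.neutral)
  also have "\<dots> = (\<Sum>z\<in>X. \<Sum>w\<in>X. c z * cnj (c w) * E z w)"
    using Y E_0(1) by (intro sum.cong refl sum.mono_neutral_right) (auto simp: X_def subset_eq)
  also have "\<dots> = (\<Sum>z\<in>X. \<Sum>w\<in>X. cnj (a z) / \<phi> z * cnj (cnj (a w) / \<phi> w) * E z w)"
    using X phi_nz by (intro sum.cong refl) (auto simp: a_def subset_eq)
  also have "\<dots> = of_real ((hnorm ip (kcomb X a))\<^sup>2 - (hnorm ip ?P)\<^sup>2 - (\<Sum>n. (hnorm ip (?G n))\<^sup>2))"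
    by (rule parts_defect[OF X, symmetric])
  finally have eq: "(\<Sum>z\<in>Y. \<Sum>w\<in>Y. c z * cnj (c w) * E z w)
      = of_real ((hnorm ip (kcomb X a))\<^sup>2 - (hnorm ip ?P)\<^sup>2 - (\<Sum>n. (hnorm ip (?G n))\<^sup>2))" .
  show "(\<Sum>z\<in>Y. \<Sum>w\<in>Y. c z * cnj (c w) * E z w) \<in> \<real> \<and> 0 \<le> Re (\<Sum>z\<in>Y. \<Sum>w\<in>Y. c z * cnj (c w) * E z w)"
    unfolding eq Re_complex_of_real using nonneg by (intro conjI Reals_of_real)
qed

section \<open>From a positive \<open>E\<close> to the row contraction\<close>

lemma E_holomorphic:
  assumes w: "w \<in> disc"
  shows "(\<lambda>z. E z w) holomorphic_on disc"
  unfolding E_def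
  by (intro holomorphic_intros kernel_holomorphic phi_holomorphic l2_inner_holomorphic u_analytic u_l2 w)

text \<open>On the diagonal both \<open>K\<close> and \<open>k\<close> are nonnegative, hence so is
  the quotient that is subtracted from \<open>1\<close>.\<close>

lemma E_diag_le_1:
  assumes z: "z \<in> disc"
  shows "Re (E z z) \<le> 1"
proof -
  let ?d = "1 - \<phi> z * cnj (\<phi> z) * (1 - l2_inner (u z) (u z))"
  have k: "0 \<le> Re (k z z)" "k z z = of_real (Re (k z z))" using psd_kernel_diag[OF psd_k z] .
  have "?d = 1 / k z z" using k_inverse[OF z z] by (metis inverse_eq_divide inverse_unique)
  then have d: "?d = of_real (1 / Re (k z z))" using k(2) by (metis of_real_1 of_real_divide)
  have "Re (E z z) = 1 - Re (K z z) * (1 / Re (k z z))" unfolding E_def d by simp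
  then show ?thesis using kernel_diag_ge_0[OF z] k(1) by simp
qed

text \<open>The value \<open>b 0 = 0\<close> comes from the normalization: \<open>E 0 0 = 0\<close>
  is the squared norm of \<open>b 0\<close>.\<close>

lemma H_kb_if_psd_E:
  assumes psd: "psd_kernel E"
  shows "\<exists>b. analytic_row_contraction b \<and> b 0 = (\<lambda>n. 0) \<and> is_H_kb H ip k b"
proof -
  obtain b where b: "analytic_row_contraction b"
    and Eb: "\<And>z w. z \<in> disc \<Longrightarrow> w \<in> disc \<Longrightarrow> E z w = l2_inner (b z) (b w)"
    using psd_kernel_factorization[OF psd E_holomorphic E_diag_le_1] by blast
  have 0: "0 \<in> disc" by simp
  have b0: "b 0 \<in> l2" using b l2_analyticD[OF _ 0] by (simp add: analytic_row_contraction_def)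
  have "l2_norm (b 0) = 0"
    using Eb[OF 0 0] E_0(1)[OF 0] l2_inner_self[OF b0] by simp
  then have "b 0 = (\<lambda>n. 0)" by (rule l2_norm_eq_0[OF b0])
  moreover have "kernel_section (\<lambda>z w. k z w * (1 - l2_inner (b z) (b w))) w = kernel_section K w"
    if w: "w \<in> disc" for w
  proof
    fix z
    show "kernel_section (\<lambda>z w. k z w * (1 - l2_inner (b z) (b w))) w z = kernel_section K w z"
      unfolding kernel_section_def using K_eq_k_E[OF _ w, of z] Eb[OF _ w, of z] by auto
  qed
  then have "is_H_kb H ip k b"
    using kernel unfolding is_H_kb_def has_reproducing_kernel_def by simp
  ultimately show ?thesis using b by blast
qed

end

theorem theorem3:
  fixes \<phi> :: "complex \<Rightarrow> complex"
    and u :: "complex \<Rightarrow> nat \<Rightarrow> complex"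
    and k K :: "complex \<Rightarrow> complex \<Rightarrow> complex"
    and H :: "(complex \<Rightarrow> complex) set"
    and ip :: "(complex \<Rightarrow> complex) \<Rightarrow> (complex \<Rightarrow> complex) \<Rightarrow> complex"
  assumes "bergman_type_kernel \<phi> u k"
    and "hilbert_analytic_space H ip"
    and "has_reproducing_kernel H ip K"
    and "normalized_at_0 K"
    and "\<phi> \<in> Mult H"
    and "closed_in_H H ip (mult_range H \<phi>)"
    and "codim_1_in_H H (mult_range H \<phi>)"
    and "u \<in> Mult_row H ip"
  shows "(\<exists>b. analytic_row_contraction b \<and> b 0 = (\<lambda>n. 0) \<and> is_H_kb H ip k b) \<longleftrightarrow>
    (\<forall>f0\<in>H. \<forall>F\<in>H_l2 H ip.
       (hnorm ip (\<lambda>z. f0 z + row_mult u F z))\<^sup>2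
         \<le> (hnorm ip (\<lambda>z. \<phi> z * f0 z))\<^sup>2 + (\<Sum>n. (hnorm ip (F n))\<^sup>2))"
proof -
  interpret bergman_rkhs H ip K \<phi> u k
    using assms by unfold_locales
  show ?thesis
  proof
    assume "\<exists>b. analytic_row_contraction b \<and> b 0 = (\<lambda>n. 0) \<and> is_H_kb H ip k b"
    then obtain b where "analytic_row_contraction b" and b: "is_H_kb H ip k b" by blast
    then have "b z \<in> l2" if "z \<in> disc" for z
      using l2_analyticD[OF _ that] by (simp add: analytic_row_contraction_def)
    then show "\<forall>f0\<in>H. \<forall>F\<in>H_l2 H ip. (hnorm ip (\<lambda>z. f0 z + row_mult u F z))\<^sup>2
        \<le> (hnorm ip (\<lambda>z. \<phi> z * f0 z))\<^sup>2 + (\<Sum>n. (hnorm ip (F n))\<^sup>2)"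
      using inequality_if_H_kb[OF _ b] by blast
  next
    assume "\<forall>f0\<in>H. \<forall>F\<in>H_l2 H ip. (hnorm ip (\<lambda>z. f0 z + row_mult u F z))\<^sup>2
        \<le> (hnorm ip (\<lambda>z. \<phi> z * f0 z))\<^sup>2 + (\<Sum>n. (hnorm ip (F n))\<^sup>2)"
    then show "\<exists>b. analytic_row_contraction b \<and> b 0 = (\<lambda>n. 0) \<and> is_H_kb H ip k b"
      by (intro H_kb_if_psd_E psd_E_if_inequality) blast
  qed
qed

end
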